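(* Let $\mathcal{X}\subset\mathbb{R}^d$ be a John domain with non-empty interior, and let $\rho$ be a probability density on $\mathcal{X}$ bounded above and below by positive constants. Then for every compact set $\mathcal{Y}\subset\mathbb{R}^d$ there exists a constant $C>0$ depending only on $\rho$ and $\mathcal{Y}$ such that for all $\psi_0,\psi_1\in C_b(\mathcal{Y})$, $$\operatorname{Var}_\rho(\psi_1^*-\psi_0^* )\le C\left(\mathcal{K}_\rho(\psi_1)-\mathcal{K}_\rho(\psi_0)+\langle\psi_1-\psi_0\,|\,(\nabla\psi_0^* )_\#\rho\rangle\right).$$
   Context: A bounded open set $\mathcal{X}\subset\mathbb{R}^d$ is a John domain if there exist a point $x_0\in\mathcal{X}$ and a constant $\eta>0$ such that for every $x\in\mathcal{X}$ there is a rectifiable curve $\omega:[0,T]\to\mathcal{X}$ parametrised by arclength with $\omega(0)=x$, $\omega(T)=x_0$ and $\operatorname{dist}(\omega(t),\mathbb{R}^d\setminus\mathcal{X})\ge\eta t$ for all $t\in[0,T]$. For $\psi\in C_b(\mathcal{Y})$, $\psi^*(x)=\sup_{y\in\mathcal{Y}}\langle x|y\rangle-\psi(y)$ is a convex function on $\mathbb{R}^d$ (differentiable Lebesgue-a.e.), and $\mathcal{K}_\rho(\psi)=\int_{\mathcal{X}}\psi^*\,\mathrm{d}\rho$. $\operatorname{Var}_\rho(f)=\int f^2\,\mathrm{d}\rho-\left(\int f\,\mathrm{d}\rho\right)^2$, and $\langle f|\nu\rangle=\int f\,\mathrm{d}\nu$. *)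

theory Defs
  imports "HOL-Probability.Probability"
begin

text \<open>The length of the restriction of \<open>\<omega>\<close> to \<open>{a..b}\<close>, as the supremum of the lengths of
  inscribed polygons; it may be infinite.\<close>

definition curve_length :: "(real \<Rightarrow> 'a::metric_space) \<Rightarrow> real \<Rightarrow> real \<Rightarrow> ennreal" where
  "curve_length \<omega> a b =
     (SUP p \<in> {p. sorted p \<and> set p \<subseteq> {a..b}}.
        ennreal (\<Sum>i<length p - 1. dist (\<omega> (p ! i)) (\<omega> (p ! Suc i))))"

definition rectifiable_curve :: "(real \<Rightarrow> 'a::metric_space) \<Rightarrow> real \<Rightarrow> real \<Rightarrow> bool" where
  "rectifiable_curve \<omega> a b \<longleftrightarrow> continuous_on {a..b} \<omega> \<and> curve_length \<omega> a b < \<infinity>"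

definition arclength_parametrised :: "(real \<Rightarrow> 'a::metric_space) \<Rightarrow> real \<Rightarrow> real \<Rightarrow> bool" where
  "arclength_parametrised \<omega> a b \<longleftrightarrow>
     (\<forall>s t. a \<le> s \<and> s \<le> t \<and> t \<le> b \<longrightarrow> curve_length \<omega> s t = ennreal (t - s))"

text \<open>The value \<open>T = 0\<close> is allowed; it is needed for \<open>x = x0\<close>.\<close>

definition John_domain :: "'a::euclidean_space set \<Rightarrow> bool" where
  "John_domain X \<longleftrightarrow> bounded X \<and> open X \<and>
     (\<exists>x0\<in>X. \<exists>\<eta>>0. \<forall>x\<in>X. \<exists>T\<ge>0. \<exists>\<omega>.
        rectifiable_curve \<omega> 0 T \<and> arclength_parametrised \<omega> 0 T \<and>
        \<omega> ` {0..T} \<subseteq> X \<and> \<omega> 0 = x \<and> \<omega> T = x0 \<and>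
        (\<forall>t\<in>{0..T}. infdist (\<omega> t) (UNIV - X) \<ge> \<eta> * t))"

definition density_on :: "'a::euclidean_space set \<Rightarrow> ('a \<Rightarrow> real) \<Rightarrow> 'a measure" where
  "density_on X \<rho> = density (lebesgue_on X) (\<lambda>x. ennreal (\<rho> x))"

definition prob_density_on :: "'a::euclidean_space set \<Rightarrow> ('a \<Rightarrow> real) \<Rightarrow> bool" where
  "prob_density_on X \<rho> \<longleftrightarrow> \<rho> \<in> borel_measurable (lebesgue_on X) \<and>
     (AE x in lebesgue_on X. 0 \<le> \<rho> x) \<and> prob_space (density_on X \<rho>)"

text \<open>Functions on \<open>Y\<close> are represented by total functions whose values outside \<open>Y\<close> are
  irrelevant.\<close>

definition C_b :: "'a::euclidean_space set \<Rightarrow> ('a \<Rightarrow> real) set" where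
  "C_b Y = {\<psi>. continuous_on Y \<psi> \<and> bounded (\<psi> ` Y)}"

text \<open>For nonempty bounded \<open>Y\<close> and \<open>\<psi> \<in> C_b Y\<close> the supremum is that of a nonempty set of reals
  that is bounded above.\<close>

definition conjugate_on :: "'a::euclidean_space set \<Rightarrow> ('a \<Rightarrow> real) \<Rightarrow> 'a \<Rightarrow> real" where
  "conjugate_on Y \<psi> x = (SUP y\<in>Y. inner x y - \<psi> y)"

text \<open>The gradient, with the conventional value \<open>0\<close> where \<open>f\<close> is not differentiable.\<close>

definition grad :: "('a::euclidean_space \<Rightarrow> real) \<Rightarrow> 'a \<Rightarrow> 'a" where
  "grad f x = (if f differentiable (at x) then (THE D. GDERIV f x :> D) else 0)"

definition Kantorovich ::
  "'a::euclidean_space set \<Rightarrow> ('a \<Rightarrow> real) \<Rightarrow> 'a set \<Rightarrow> ('a \<Rightarrow> real) \<Rightarrow> real" where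
  "Kantorovich X \<rho> Y \<psi> = (LINT x|density_on X \<rho>. conjugate_on Y \<psi> x)"

definition Var :: "'a measure \<Rightarrow> ('a \<Rightarrow> real) \<Rightarrow> real" where
  "Var M f = (LINT x|M. (f x)\<^sup>2) - (LINT x|M. f x)\<^sup>2"

end

theory Submission
  imports Defs
begin

text \<open>Write \<open>\<phi>\<^sub>i\<close> for the conjugate of \<open>\<psi>\<^sub>i\<close> and \<open>f = \<phi>\<^sub>1 - \<phi>\<^sub>0\<close>. For almost every \<open>x\<close> the gradient
  \<open>y = \<nabla>\<phi>\<^sub>0(x)\<close> is the unique maximiser in \<open>Y\<close>, so the right-hand side is the integral of the
  Fenchel--Young gap \<open>\<phi>\<^sub>1(x) + \<psi>\<^sub>1(y) - \<langle>x|y\<rangle>\<close>, which dominates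
  \<open>\<phi>\<^sub>1(x) - \<phi>\<^sub>1(x - v) - \<phi>\<^sub>0(x + v) + \<phi>\<^sub>0(x)\<close> for every \<open>v\<close>. Integrating the latter along a segment
  from \<open>p\<close> to \<open>q\<close> with \<open>v = \<delta>(q - p)\<close> gives \<open>\<delta>(f(q) - f(p))\<close> up to an error \<open>O(\<delta>\<^sup>2)\<close>, as the \<open>\<phi>\<^sub>i\<close>
  are Lipschitz. Optimising in \<open>\<delta>\<close> bounds \<open>(f(p) - f(q))\<^sup>2\<close> by a multiple of \<open>|p - q|\<close> times the mean
  of the gap over the segment.

  This segment estimate replaces the gradient bound in a Poincare inequality on John domains: chain
  along the John curve of \<open>x\<close> through the points \<open>\<omega>(t\<^sub>k) + (\<eta>/4)t\<^sub>kw\<close> with geometric \<open>t\<^sub>k\<close>,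
  average over \<open>w\<close> in the unit ball, use Cauchy--Schwarz with geometric weights, and integrate over
  \<open>x\<close>. The factor \<open>|p - q|\<close>, here at most \<open>t\<^sub>k\<close>, absorbs the geometric weights and keeps the
  sum over the scales convergent, so no covering or maximal function argument is needed.\<close>

subsection \<open>The segment inequality\<close>

lemma nn_integral_continuous_Icc:
  fixes k :: "real \<Rightarrow> real"
  assumes cont: "continuous_on {a..b} k" and nonneg: "\<And>s. s \<in> {a..b} \<Longrightarrow> 0 \<le> k s"
  shows "(\<integral>\<^sup>+s\<in>{a..b}. ennreal (k s) \<partial>lborel) = ennreal (integral {a..b} k)"
proof -
  have int: "set_integrable lborel {a..b} k" by (rule borel_integrable_atLeastAtMost'[OF cont])
  have "(\<integral>\<^sup>+s\<in>{a..b}. ennreal (k s) \<partial>lborel) = (\<integral>\<^sup>+s. ennreal (indicator {a..b} s *\<^sub>R k s) \<partial>lborel)"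
    by (intro nn_integral_cong) (auto simp: indicator_def)
  also have "\<dots> = ennreal (LINT s:{a..b}|lborel. k s)"
    unfolding set_lebesgue_integral_def using int nonneg
    by (intro nn_integral_eq_integral) (auto simp: set_integrable_def indicator_def)
  finally show ?thesis by (simp add: set_borel_integral_eq_integral(2)[OF int])
qed

text \<open>If \<open>G\<close> is an antiderivative of \<open>F\<close>, the integral is (G(1 + d)
  - G(d)) - (G(1) - G(0)). Its derivative in \<open>d\<close> is F(1 + d) - F(d), which differs from
  F(1) - F(0) by at most 2L|d|; the mean value inequality turns this into the quadratic
  error.\<close>

lemma shift_integral_bound:
  fixes F :: "real \<Rightarrow> real"
  assumes lip: "\<And>s t. \<bar>F s - F t\<bar> \<le> L * \<bar>s - t\<bar>"
  shows "\<bar>integral {0..1} (\<lambda>s. F (s + d) - F s) - d * (F 1 - F 0)\<bar> \<le> 2 * L * d\<^sup>2"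
proof -
  have L: "0 \<le> L" using lip[of 1 0] by simp
  have cont: "continuous_on S F" for S
    by (rule lipschitz_on_continuous_on[of L]) (auto simp: lipschitz_on_def dist_real_def L lip)
  \<comment> \<open>The margins keep \<open>s + d\<close>, \<open>1 + t\<close> and
    \<open>t\<close>, for s in [0,1] and |t| \<le> |d|, strictly inside [a, b], where the one-sided
    derivative of \<open>G\<close> is two-sided.\<close>
  define a where "a = - \<bar>d\<bar> - 1"
  define b where "b = \<bar>d\<bar> + 2"
  obtain G where G: "\<And>x. x \<in> {a..b} \<Longrightarrow> (G has_vector_derivative F x) (at x within {a..b})"
    using antiderivative_continuous[OF cont] by blast
  have G': "(G has_real_derivative F x) (at x)" if "a < x" "x < b" for x
    using G[of x] that by (simp add: at_within_Icc_at has_real_derivative_iff_has_vector_derivative)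
  have *: "((\<lambda>s. G (s + d) - G s) has_real_derivative F (s + d) - F s) (at s)" if "s \<in> {0..1}" for s
  proof -
    have "((\<lambda>s. G (s + d)) has_real_derivative F (s + d)) (at s)"
      using DERIV_shift[of G "F (s + d)" s d] G'[of "s + d"] that
      unfolding a_def b_def atLeastAtMost_iff by linarith
    moreover have "(G has_real_derivative F s) (at s)"
      using G'[of s] that unfolding a_def b_def atLeastAtMost_iff by linarith
    ultimately show ?thesis by (rule DERIV_diff)
  qed
  have "((\<lambda>s. F (s + d) - F s) has_integral (G (1 + d) - G 1) - (G (0 + d) - G 0)) {0..1}"
    by (rule fundamental_theorem_of_calculus)
       (auto intro!: has_field_derivative_at_within *
             simp flip: has_real_derivative_iff_has_vector_derivative)
  then have int: "integral {0..1} (\<lambda>s. F (s + d) - F s) = (G (1 + d) - G 1) - (G d - G 0)"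
    by (simp add: integral_unique)
  define P where "P t = G (1 + t) - G t - t * (F 1 - F 0)" for t
  have dP: "(P has_real_derivative F (1 + t) - F t - (F 1 - F 0)) (at t)" if "t \<in> closed_segment 0 d" for t
  proof -
    have t: "\<bar>t\<bar> \<le> \<bar>d\<bar>" using that by (auto simp: closed_segment_eq_real_ivl split: if_splits)
    have "((\<lambda>s. G (1 + s)) has_real_derivative F (1 + t)) (at t)"
      using DERIV_shift[of G "F (1 + t)" t 1] G'[of "1 + t"] t
      unfolding a_def b_def by (simp add: add.commute)
    moreover have "(G has_real_derivative F t) (at t)"
      using G'[of t] t unfolding a_def b_def by linarith
    ultimately show ?thesis unfolding P_def by (auto intro!: derivative_eq_intros)
  qed
  have "norm (P d - P 0) \<le> (2 * L * \<bar>d\<bar>) * norm (d - 0)"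
  proof (rule field_differentiable_bound[of "closed_segment 0 d"])
    show "convex (closed_segment 0 d)" by simp
    show "(P has_real_derivative F (1 + t) - F t - (F 1 - F 0)) (at t within closed_segment 0 d)"
      if "t \<in> closed_segment 0 d" for t using dP[OF that] by (rule has_field_derivative_at_within)
    show "norm (F (1 + t) - F t - (F 1 - F 0)) \<le> 2 * L * \<bar>d\<bar>" if "t \<in> closed_segment 0 d" for t
    proof -
      have t: "\<bar>t\<bar> \<le> \<bar>d\<bar>" using that by (auto simp: closed_segment_eq_real_ivl split: if_splits)
      have "norm (F (1 + t) - F t - (F 1 - F 0)) \<le> \<bar>F (1 + t) - F 1\<bar> + \<bar>F t - F 0\<bar>" by simp
      also have "\<dots> \<le> L * \<bar>t\<bar> + L * \<bar>t\<bar>"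
        using lip[of "1 + t" 1] lip[of t 0] by simp
      also have "\<dots> \<le> 2 * L * \<bar>d\<bar>" using mult_left_mono[OF t L] by simp
      finally show ?thesis .
    qed
  qed auto
  then show ?thesis unfolding int P_def by (simp add: power2_eq_square algebra_simps)
qed

text \<open>Only an upper bound \<open>H\<close> for the second-order expressions is assumed. Since
  it holds for all \<open>v\<close> at once, the shift may be chosen as the best multiple of q -
  p.\<close>

lemma segment_inequality:
  fixes f g :: "'a::euclidean_space \<Rightarrow> real"
  assumes R: "0 < R"
    and f: "\<And>x y. \<bar>f x - f y\<bar> \<le> R * dist x y"
    and g: "\<And>x y. \<bar>g x - g y\<bar> \<le> R * dist x y"
    and H: "\<And>x v. ennreal (g x - g (x - v) - f (x + v) + f x) \<le> H x"
  shows "ennreal (((g p - f p) - (g q - f q))\<^sup>2)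
      \<le> ennreal (16 * R * dist p q) * (\<integral>\<^sup>+s\<in>{0..1}. H (p + s *\<^sub>R (q - p)) \<partial>lborel)"
proof (cases "p = q")
  case False
  define e where "e = q - p"
  define L where "L = R * norm e"
  have L: "0 < L" using R False by (simp add: L_def e_def)
  define F where "F s = f (p + s *\<^sub>R e)" for s
  define G where "G s = g (p + s *\<^sub>R e)" for s
  have e1: "dist (p + s *\<^sub>R e) (p + t *\<^sub>R e) = \<bar>s - t\<bar> * norm e" for s t
  proof -
    have "p + s *\<^sub>R e - (p + t *\<^sub>R e) = (s - t) *\<^sub>R e" by (simp add: scaleR_diff_left)
    then show ?thesis by (simp add: dist_norm)
  qed
  have F: "\<bar>F s - F t\<bar> \<le> L * \<bar>s - t\<bar>" for s t
    using f[of "p + s *\<^sub>R e" "p + t *\<^sub>R e"] by (simp add: F_def e1 L_def mult_ac)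
  have G: "\<bar>G s - G t\<bar> \<le> L * \<bar>s - t\<bar>" for s t
    using g[of "p + s *\<^sub>R e" "p + t *\<^sub>R e"] by (simp add: G_def e1 L_def mult_ac)
  have cF [continuous_intros]: "continuous_on S (\<lambda>x. F (h x))" if "continuous_on S h" for S h
    by (rule continuous_on_compose2[OF lipschitz_on_continuous_on[of L UNIV] that])
       (use F L in \<open>auto simp: lipschitz_on_def dist_real_def\<close>)
  have cG [continuous_intros]: "continuous_on S (\<lambda>x. G (h x))" if "continuous_on S h" for S h
    by (rule continuous_on_compose2[OF lipschitz_on_continuous_on[of L UNIV] that])
       (use G L in \<open>auto simp: lipschitz_on_def dist_real_def\<close>)
  define D where "D = (G 1 - F 1) - (G 0 - F 0)"
  \<comment> \<open>The maximiser of d D - 4 L d^2; the maximum D^2 / (16 L) is the source of the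
    factor 16.\<close>
  define d where "d = D / (8 * L)"
  define k where "k s = G s - G (s - d) - F (s + d) + F s" for s
  \<comment> \<open>With v = d e the integrand consists of a shift of \<open>G\<close> by -d and one
    of \<open>F\<close> by d. Their first-order terms d(G 1 - G 0) and -d(F 1 - F 0) add up to d D,
    and each contributes an error of at most 2 L d^2.\<close>
  have "integral {0..1} k = - integral {0..1} (\<lambda>s. G (s + - d) - G s) - integral {0..1} (\<lambda>s. F (s + d) - F s)"
  proof -
    have "integral {0..1} k = integral {0..1} (\<lambda>s. - (G (s + - d) - G s) - (F (s + d) - F s))"
      by (rule arg_cong2[where f=integral]) (auto simp: k_def)
    also have "\<dots> = integral {0..1} (\<lambda>s. - (G (s + - d) - G s)) - integral {0..1} (\<lambda>s. F (s + d) - F s)"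
      by (rule integral_diff) (auto intro!: integrable_continuous_real continuous_intros)
    finally show ?thesis by (simp only: integral_neg)
  qed
  then have "integral {0..1} k \<ge> d * D - 4 * L * d\<^sup>2"
    using shift_integral_bound[OF F, of d] shift_integral_bound[OF G, of "- d"]
    unfolding D_def by (auto simp: abs_le_iff algebra_simps)
  also have "d * D - 4 * L * d\<^sup>2 = D\<^sup>2 / (16 * L)"
    using L by (simp add: d_def power2_eq_square field_simps)
  finally have k1: "D\<^sup>2 / (16 * L) \<le> integral {0..1} k" .
  have ck: "continuous_on {0..1} k" unfolding k_def by (intro continuous_intros)
  \<comment> \<open>\<open>k\<close> may change sign, while \<open>ennreal\<close> cuts off negative
    values; passing to the positive part only enlarges the integral.\<close>
  have ckp: "continuous_on {0..1} (\<lambda>s. max 0 (k s))" by (intro continuous_on_max continuous_intros ck)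
  have "ennreal (integral {0..1} k) \<le> ennreal (integral {0..1} (\<lambda>s. max 0 (k s)))"
    by (intro ennreal_leI integral_le integrable_continuous_real ck ckp) auto
  also have "\<dots> = (\<integral>\<^sup>+s\<in>{0..1}. ennreal (max 0 (k s)) \<partial>lborel)"
    by (intro nn_integral_continuous_Icc[symmetric] ckp) auto
  also have "\<dots> \<le> (\<integral>\<^sup>+s\<in>{0..1}. H (p + s *\<^sub>R (q - p)) \<partial>lborel)"
  proof (intro nn_integral_mono)
    fix s
    have "ennreal (k s) \<le> H (p + s *\<^sub>R e)"
      using H[of "p + s *\<^sub>R e" "d *\<^sub>R e"] by (simp add: k_def F_def G_def algebra_simps)
    then show "ennreal (max 0 (k s)) * indicator {0..1} s \<le> H (p + s *\<^sub>R (q - p)) * indicator {0..1} s"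
      by (auto simp: indicator_def e_def max_def)
  qed
  finally have *: "ennreal (integral {0..1} k) \<le> (\<integral>\<^sup>+s\<in>{0..1}. H (p + s *\<^sub>R (q - p)) \<partial>lborel)" .
  have "D\<^sup>2 = 16 * L * (D\<^sup>2 / (16 * L))" using L by simp
  also have "\<dots> \<le> 16 * L * integral {0..1} k" using k1 L by (intro mult_left_mono) auto
  finally have "ennreal (D\<^sup>2) \<le> ennreal (16 * L) * ennreal (integral {0..1} k)"
    using L by (simp add: ennreal_leI flip: ennreal_mult')
  also have "\<dots> \<le> ennreal (16 * L) * (\<integral>\<^sup>+s\<in>{0..1}. H (p + s *\<^sub>R (q - p)) \<partial>lborel)"
    by (intro mult_left_mono *) simp
  finally show ?thesis
    by (simp add: D_def F_def G_def L_def e_def dist_norm norm_minus_commute power2_commute mult.assoc)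
qed simp

subsection \<open>A Poincare inequality on John domains\<close>

text \<open>The chord is an inscribed polygon with the two vertices at \<open>s\<close> and
  \<open>t\<close>.\<close>

lemma arclength_parametrised_dist_le:
  assumes "arclength_parametrised \<omega> a b" "a \<le> s" "s \<le> t" "t \<le> b"
  shows "dist (\<omega> s) (\<omega> t) \<le> t - s"
proof -
  have "ennreal (\<Sum>i<length [s, t] - 1. dist (\<omega> ([s, t] ! i)) (\<omega> ([s, t] ! Suc i))) \<le> curve_length \<omega> s t"
    unfolding curve_length_def by (rule SUP_upper) (use assms in auto)
  then have "ennreal (dist (\<omega> s) (\<omega> t)) \<le> ennreal (t - s)"
    using assms by (simp add: arclength_parametrised_def)
  then show ?thesis using assms by (subst (asm) ennreal_le_iff) auto
qed

text \<open>The John curves are kept constant once they have reached \<open>x0\<close>; this makes \<open>T\<close>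
  independent of the starting point.\<close>

lemma John_domain_uniform_curves:
  fixes X :: "'a::euclidean_space set"
  assumes "John_domain X"
  obtains T \<eta> x0 where "0 < T" "0 < \<eta>" "\<eta> \<le> 1"
    "\<And>x. x \<in> X \<Longrightarrow> \<exists>\<omega>. \<omega> 0 = x \<and> \<omega> T = x0 \<and>
       (\<forall>s t. 0 \<le> s \<longrightarrow> s \<le> t \<longrightarrow> t \<le> T \<longrightarrow> dist (\<omega> s) (\<omega> t) \<le> t - s) \<and>
       (\<forall>t. 0 < t \<longrightarrow> t \<le> T \<longrightarrow> ball (\<omega> t) (\<eta> * t) \<subseteq> X)"
proof -
  obtain x0 \<eta> where X: "bounded X" "open X" "x0 \<in> X" "0 < \<eta>"
    and curves: "\<And>x. x \<in> X \<Longrightarrow> \<exists>T\<ge>0. \<exists>\<omega>.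
        rectifiable_curve \<omega> 0 T \<and> arclength_parametrised \<omega> 0 T \<and>
        \<omega> ` {0..T} \<subseteq> X \<and> \<omega> 0 = x \<and> \<omega> T = x0 \<and>
        (\<forall>t\<in>{0..T}. infdist (\<omega> t) (UNIV - X) \<ge> \<eta> * t)"
    using assms unfolding John_domain_def
    by (elim conjE bexE exE) (rule that, assumption+, erule (1) bspec)
  \<comment> \<open>The John condition at the end point bounds the length of every curve by this
    number. Since \<eta> T is exactly the distance of \<open>x0\<close> from the complement, resting
    at \<open>x0\<close> until time \<open>T\<close> preserves the condition.\<close>
  define T where "T = infdist x0 (UNIV - X) / \<eta>"
  \<comment> \<open>\<open>infdist\<close> to the empty set is 0, so positivity needs a point
    outside the bounded set \<open>X\<close>.\<close>
  have "UNIV - X \<noteq> {}" using X(1) not_bounded_UNIV by (metis Diff_eq_empty_iff top.extremum_uniqueI)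
  moreover have "closed (UNIV - X)" using X(2) by (simp add: closed_Diff)
  ultimately have "0 < infdist x0 (UNIV - X)" using X(3) by (intro infdist_pos_not_in_closed) auto
  then have T: "0 < T" "infdist x0 (UNIV - X) = \<eta> * T" using X(4) by (auto simp: T_def)
  show ?thesis
  \<comment> \<open>Decreasing \<eta> weakens the John condition, so \<eta> \<le> 1 costs
    nothing.\<close>
  proof (rule that[of T "min \<eta> 1" x0])
    fix x assume "x \<in> X"
    from curves[OF this] obtain T' \<omega> where \<omega>: "0 \<le> T'" "arclength_parametrised \<omega> 0 T'" "\<omega> 0 = x" "\<omega> T' = x0"
      and inf: "\<And>t. 0 \<le> t \<Longrightarrow> t \<le> T' \<Longrightarrow> infdist (\<omega> t) (UNIV - X) \<ge> \<eta> * t" by auto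
    have T': "T' \<le> T" using inf[of T'] \<omega> X(4) T by simp
    define \<gamma> where "\<gamma> t = \<omega> (min t T')" for t
    show "\<exists>\<omega>. \<omega> 0 = x \<and> \<omega> T = x0 \<and>
       (\<forall>s t. 0 \<le> s \<longrightarrow> s \<le> t \<longrightarrow> t \<le> T \<longrightarrow> dist (\<omega> s) (\<omega> t) \<le> t - s) \<and>
       (\<forall>t. 0 < t \<longrightarrow> t \<le> T \<longrightarrow> ball (\<omega> t) (min \<eta> 1 * t) \<subseteq> X)"
    proof (intro exI[of _ \<gamma>] conjI allI impI)
      show "\<gamma> 0 = x" "\<gamma> T = x0" using \<omega> T' by (auto simp: \<gamma>_def min_def)
    next
      fix s t :: real assume "0 \<le> s" "s \<le> t" "t \<le> T"
      then show "dist (\<gamma> s) (\<gamma> t) \<le> t - s"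
        using arclength_parametrised_dist_le[OF \<omega>(2), of "min s T'" "min t T'"] \<omega>(1)
        by (auto simp: \<gamma>_def min_def split: if_splits)
    next
      fix t :: real assume t: "0 < t" "t \<le> T"
      have "\<eta> * t \<le> infdist (\<gamma> t) (UNIV - X)"
      proof (cases "t \<le> T'")
        case False
        then show ?thesis using T \<omega> X(4) t by (simp add: \<gamma>_def min_def)
      qed (use inf[of t] t in \<open>simp add: \<gamma>_def\<close>)
      moreover have "min \<eta> 1 * t \<le> \<eta> * t" using t by (intro mult_right_mono) auto
      ultimately have le: "min \<eta> 1 * t \<le> infdist (\<gamma> t) (UNIV - X)" by linarith
      show "ball (\<gamma> t) (min \<eta> 1 * t) \<subseteq> X"
      proof
        fix y assume "y \<in> ball (\<gamma> t) (min \<eta> 1 * t)"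
        then show "y \<in> X" using infdist_le[of y "UNIV - X" "\<gamma> t"] le by auto
      qed
    qed
  qed (use T X in auto)
qed

section \<open>Scaling of integrals over balls\<close>

lemma nn_integral_unit_cball_affine:
  fixes b :: "'a::euclidean_space"
  assumes [measurable]: "H \<in> borel_measurable borel" and r: "0 < r"
  shows "(\<integral>\<^sup>+w\<in>cball 0 1. H (b + r *\<^sub>R w) \<partial>lborel)
      = ennreal ((1 / r) ^ DIM('a)) * (\<integral>\<^sup>+z\<in>cball b r. H z \<partial>lborel)"
proof -
  have "(\<integral>\<^sup>+z\<in>cball b r. H z \<partial>lborel)
      = ennreal (r ^ DIM('a)) * (\<integral>\<^sup>+w\<in>cball 0 1. H (b + r *\<^sub>R w) \<partial>lborel)"
    using r
    by (subst lborel_affine[of r b])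
       (auto simp: nn_integral_density nn_integral_distr nn_integral_cmult dist_norm indicator_def
             intro!: nn_integral_cong arg_cong2[where f="(*)"])
  moreover have "ennreal ((1 / r) ^ DIM('a)) * ennreal (r ^ DIM('a)) = 1"
    using r by (simp flip: ennreal_mult' add: power_one_over)
  ultimately show ?thesis by (simp add: mult.assoc[symmetric])
qed

lemma emeasure_lborel_cball_scale:
  fixes b :: "'a::euclidean_space"
  assumes "0 < r"
  shows "emeasure lborel (cball b r) = ennreal (r ^ DIM('a)) * emeasure lborel (cball (0::'a) 1)"
proof -
  have "emeasure lborel (cball (0::'a) 1) = ennreal ((1 / r) ^ DIM('a)) * emeasure lborel (cball b r)"
    using nn_integral_unit_cball_affine[of "\<lambda>_. 1" r b] assms by simp
  moreover have "ennreal (r ^ DIM('a)) * ennreal ((1 / r) ^ DIM('a)) = 1"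
    using assms by (simp flip: ennreal_mult' add: power_one_over)
  ultimately show ?thesis by (simp add: mult.assoc[symmetric])
qed

section \<open>Chaining along John curves\<close>

text \<open>\<open>H\<close> plays the part of a squared gradient, for which Cauchy--Schwarz would
  give the square of the distance as factor. Here only its first power is available.\<close>

definition segment_bound :: "('a::euclidean_space \<Rightarrow> real) \<Rightarrow> ('a \<Rightarrow> ennreal) \<Rightarrow> bool" where
  "segment_bound f H \<longleftrightarrow> (\<forall>p q. ennreal ((f p - f q)\<^sup>2)
      \<le> ennreal (dist p q) * (\<integral>\<^sup>+s\<in>{0..1}. H (p + s *\<^sub>R (q - p)) \<partial>lborel))"

text \<open>At parameter \<open>s\<close> the segment belonging to \<open>w\<close> passes through
  \<open>c s + r s * w\<close>, so letting \<open>w\<close> vary over the unit ball sweeps out the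
  ball around \<open>c s\<close> of radius \<open>r s\<close>. Fubini and an affine substitution for
  each fixed \<open>s\<close> turn the segment integrals into integrals over such balls, at the cost
  of the Jacobian (1 / r s)^d, where d is the dimension.\<close>

lemma segment_bound_chain_step:
  fixes f :: "'a::euclidean_space \<Rightarrow> real"
  assumes f: "segment_bound f H"
    and H [measurable]: "H \<in> borel_measurable borel"
    and \<eta>: "0 < \<eta>" "\<eta> \<le> 1" and t: "0 < t'" "t' \<le> t" "(1 - \<eta> / 4) * t \<le> t'"
    and a: "ball a (\<eta> * t) \<subseteq> X" "dist x a \<le> t" and ab: "dist a b \<le> t - t'"
  shows "(\<integral>\<^sup>+w\<in>cball 0 1. ennreal ((f (a + (\<eta> / 4 * t) *\<^sub>R w) - f (b + (\<eta> / 4 * t') *\<^sub>R w))\<^sup>2) \<partial>lborel)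
     \<le> ennreal (t * (4 / (\<eta> * t')) ^ DIM('a)) * (\<integral>\<^sup>+z\<in>X \<inter> cball x (2 * t). H z \<partial>lborel)"
proof -
  define r where "r s = \<eta> / 4 * (t + s * (t' - t))" for s
  define c where "c s = a + s *\<^sub>R (b - a)" for s
  define J where "J = (\<integral>\<^sup>+z\<in>X \<inter> cball x (2 * t). H z \<partial>lborel)"
  have t0: "0 < t" using t by linarith
  \<comment> \<open>Consecutive centres are at most \<eta> t / 4 apart and the radii are at most
    \<eta> t / 4. Hence all the balls stay within \<eta> t / 2 of \<open>a\<close>, well inside
    \<open>X\<close>.\<close>
  have tt: "t - t' \<le> \<eta> / 4 * t" using t by (simp add: algebra_simps)
  have r: "\<eta> / 4 * t' \<le> r s \<and> r s \<le> \<eta> / 4 * t" if "s \<in> {0..1}" for s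
  proof -
    have "s * (t - t') \<le> 1 * (t - t')" "0 \<le> s * (t - t')" using that t mult_right_mono[of s 1 "t - t'"] by auto
    then have "t' \<le> t + s * (t' - t)" "t + s * (t' - t) \<le> t" by (auto simp: algebra_simps)
    then show ?thesis unfolding r_def using \<eta> by (intro conjI mult_left_mono) auto
  qed
  have r0: "0 < r s" if "s \<in> {0..1}" for s
  proof -
    have "0 < \<eta> / 4 * t'" using \<eta> t by simp
    then show ?thesis using r[OF that] by linarith
  qed
  have sub: "cball (c s) (r s) \<subseteq> X \<inter> cball x (2 * t)" if s: "s \<in> {0..1}" for s
  proof
    fix z assume z: "z \<in> cball (c s) (r s)"
    have "dist a (c s) = s * dist a b" using s by (simp add: c_def dist_norm norm_minus_commute)
    also have "\<dots> \<le> 1 * dist a b" using s by (intro mult_right_mono) auto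
    finally have "dist a (c s) \<le> \<eta> / 4 * t" using ab tt by linarith
    moreover have "dist (c s) z \<le> \<eta> / 4 * t" using z r[OF s] by simp
    ultimately have "dist a z \<le> \<eta> * t / 2" using dist_triangle[of a z "c s"] by linarith
    moreover have "0 < \<eta> * t" "\<eta> * t \<le> 1 * t" using \<eta> t0 mult_right_mono[of \<eta> 1 t] by auto
    ultimately have "dist a z < \<eta> * t" "dist a z \<le> t" by linarith+
    then show "z \<in> X \<inter> cball x (2 * t)" using a dist_triangle[of x z a] by auto
  qed
  have ball: "(\<integral>\<^sup>+w\<in>cball 0 1. H (c s + r s *\<^sub>R w) \<partial>lborel) \<le> ennreal ((4 / (\<eta> * t')) ^ DIM('a)) * J"
    if s: "s \<in> {0..1}" for s
  proof -
    have "1 / r s \<le> 4 / (\<eta> * t')"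
      using divide_left_mono[of "\<eta> / 4 * t'" "r s" 1] r[OF s] r0[OF s] \<eta> t by simp
    then have "(1 / r s) ^ DIM('a) \<le> (4 / (\<eta> * t')) ^ DIM('a)"
      using r0[OF s] by (intro power_mono) auto
    moreover have "(\<integral>\<^sup>+z\<in>cball (c s) (r s). H z \<partial>lborel) \<le> J"
      unfolding J_def using sub[OF s] by (intro nn_integral_mono mult_left_mono) (auto simp: indicator_def)
    ultimately show ?thesis
      unfolding nn_integral_unit_cball_affine[OF H r0[OF s]]
      by (intro mult_mono ennreal_leI) auto
  qed
  have pt: "ennreal ((f (a + (\<eta> / 4 * t) *\<^sub>R w) - f (b + (\<eta> / 4 * t') *\<^sub>R w))\<^sup>2)
       \<le> ennreal t * (\<integral>\<^sup>+s\<in>{0..1}. H (c s + r s *\<^sub>R w) \<partial>lborel)" if w: "w \<in> cball 0 1" for w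
  proof -
    define p where "p = a + (\<eta> / 4 * t) *\<^sub>R w"
    define q where "q = b + (\<eta> / 4 * t') *\<^sub>R w"
    \<comment> \<open>Both end points are affine in \<open>w\<close>, so each intermediate point is
      as well, with \<open>w\<close> scaled by \<open>r s\<close>.\<close>
    have eq: "p + s *\<^sub>R (q - p) = c s + r s *\<^sub>R w" for s
    proof -
      have "r s *\<^sub>R w = (\<eta> / 4 * t + s * (\<eta> / 4 * t' - \<eta> / 4 * t)) *\<^sub>R w"
        by (simp add: r_def field_simps)
      also have "\<dots> = (\<eta> / 4 * t) *\<^sub>R w + s *\<^sub>R ((\<eta> / 4 * t') *\<^sub>R w - (\<eta> / 4 * t) *\<^sub>R w)"
        by (simp only: scaleR_add_left scaleR_diff_left scaleR_scaleR[symmetric] scaleR_diff_right)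
      finally show ?thesis
        unfolding p_def q_def c_def by (simp only: scaleR_diff_right scaleR_add_right) simp
    qed
    have "dist p q \<le> dist a b + norm ((\<eta> / 4 * (t - t')) *\<^sub>R w)"
    proof -
      have "p - q = (a - b) + (\<eta> / 4 * (t - t')) *\<^sub>R w"
        unfolding p_def q_def right_diff_distrib scaleR_diff_left by simp
      then show ?thesis using norm_triangle_ineq[of "a - b" "(\<eta> / 4 * (t - t')) *\<^sub>R w"] by (simp add: dist_norm)
    qed
    also have "norm ((\<eta> / 4 * (t - t')) *\<^sub>R w) \<le> (\<eta> / 4 * (t - t')) * 1"
      unfolding norm_scaleR using w \<eta> t by (intro mult_mono) auto
    also have "\<dots> \<le> 1 * (t - t')" using \<eta> t by (simp only: mult_1_right, intro mult_right_mono) auto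
    finally have "dist p q \<le> 2 * (t - t')" using ab by simp
    also have "\<dots> \<le> 2 * (\<eta> / 4 * t)" using tt by simp
    also have "\<dots> \<le> t" using mult_right_mono[of \<eta> 1 t] \<eta> t0 by simp
    finally have d: "dist p q \<le> t" .
    have "ennreal ((f p - f q)\<^sup>2) \<le> ennreal (dist p q) * (\<integral>\<^sup>+s\<in>{0..1}. H (p + s *\<^sub>R (q - p)) \<partial>lborel)"
      using f by (simp add: segment_bound_def)
    also have "\<dots> \<le> ennreal t * (\<integral>\<^sup>+s\<in>{0..1}. H (p + s *\<^sub>R (q - p)) \<partial>lborel)"
      using d by (intro mult_right_mono ennreal_leI) auto
    finally show ?thesis unfolding eq unfolding p_def q_def .
  qed
  have [measurable]: "cball (0::'a) 1 \<in> sets borel" by simp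
  have [measurable]: "c \<in> borel_measurable borel" "r \<in> borel_measurable borel"
    unfolding c_def[abs_def] r_def[abs_def] by measurable
  have "(\<integral>\<^sup>+w\<in>cball 0 1. ennreal ((f (a + (\<eta> / 4 * t) *\<^sub>R w) - f (b + (\<eta> / 4 * t') *\<^sub>R w))\<^sup>2) \<partial>lborel)
      \<le> (\<integral>\<^sup>+w. ennreal t * (\<integral>\<^sup>+s. H (c s + r s *\<^sub>R w) * indicator {0..1} s * indicator (cball 0 1) w \<partial>lborel) \<partial>lborel)"
    using pt by (intro nn_integral_mono) (auto simp: indicator_def)
  also have "\<dots> = ennreal t * (\<integral>\<^sup>+w. (\<integral>\<^sup>+s. H (c s + r s *\<^sub>R w) * indicator {0..1} s * indicator (cball 0 1) w \<partial>lborel) \<partial>lborel)"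
    by (intro nn_integral_cmult) measurable
  also have "(\<integral>\<^sup>+w. (\<integral>\<^sup>+s. H (c s + r s *\<^sub>R w) * indicator {0..1} s * indicator (cball 0 1) w \<partial>lborel) \<partial>lborel)
      = (\<integral>\<^sup>+s. (\<integral>\<^sup>+w. H (c s + r s *\<^sub>R w) * indicator {0..1} s * indicator (cball 0 1) w \<partial>lborel) \<partial>lborel)"
    by (intro lborel_pair.Fubini') measurable
  also have "\<dots> \<le> (\<integral>\<^sup>+s\<in>{0..1::real}. ennreal ((4 / (\<eta> * t')) ^ DIM('a)) * J \<partial>lborel)"
    using ball by (intro nn_integral_mono) (auto simp: indicator_def)
  also have "\<dots> = ennreal ((4 / (\<eta> * t')) ^ DIM('a)) * J"
    by (simp add: nn_integral_cmult)
  finally show ?thesis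
    using t0 unfolding J_def[symmetric] by (simp add: ennreal_mult' mult.assoc mult_left_mono)
qed

text \<open>Telescope, split each increment as \<nu>^k times the rest, and sum the squared weights
  as a geometric series. The full series on the right makes the bound independent of
  \<open>N\<close>, so that \<open>N\<close> can tend to infinity.\<close>

lemma geometric_Cauchy_Schwarz:
  fixes a :: "nat \<Rightarrow> real"
  assumes \<nu>: "0 < \<nu>" "\<nu> < 1"
  shows "ennreal ((a N - a 0)\<^sup>2)
    \<le> ennreal (1 / (1 - \<nu>\<^sup>2)) * (\<Sum>k. ennreal (1 / \<nu> ^ (2 * k)) * ennreal ((a k - a (Suc k))\<^sup>2))"
proof -
  have \<nu>2: "\<nu>\<^sup>2 < 1" using \<nu> by (simp add: power_less_one_iff)
  define S where "S = (\<Sum>k<N. 1 / \<nu> ^ (2 * k) * (a k - a (Suc k))\<^sup>2)"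
  have "(a N - a 0)\<^sup>2 = (\<Sum>k<N. \<nu> ^ k * ((a (Suc k) - a k) / \<nu> ^ k))\<^sup>2"
    using \<nu> by (simp add: sum_lessThan_telescope)
  also have "\<dots> \<le> (\<Sum>k<N. (\<nu> ^ k)\<^sup>2) * (\<Sum>k<N. ((a (Suc k) - a k) / \<nu> ^ k)\<^sup>2)"
    by (rule Cauchy_Schwarz_ineq_sum)
  also have "(\<Sum>k<N. ((a (Suc k) - a k) / \<nu> ^ k)\<^sup>2) = S"
    unfolding S_def by (intro sum.cong) (auto simp: power_divide power2_commute mult.commute simp flip: power_mult)
  also have "(\<Sum>k<N. (\<nu> ^ k)\<^sup>2) \<le> 1 / (1 - \<nu>\<^sup>2)"
  proof -
    have "(\<Sum>k<N. (\<nu> ^ k)\<^sup>2) = (\<Sum>k<N. (\<nu>\<^sup>2) ^ k)" by (simp add: power_mult[symmetric] mult.commute)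
    also have "\<dots> \<le> (\<Sum>k. (\<nu>\<^sup>2) ^ k)"
      using \<nu> \<nu>2 by (intro sum_le_suminf) auto
    finally show ?thesis using \<nu> \<nu>2 by (simp add: suminf_geometric)
  qed
  finally have *: "(a N - a 0)\<^sup>2 \<le> 1 / (1 - \<nu>\<^sup>2) * S"
    by (simp add: mult_right_mono S_def sum_nonneg)
  have "ennreal S = (\<Sum>k<N. ennreal (1 / \<nu> ^ (2 * k)) * ennreal ((a k - a (Suc k))\<^sup>2))"
    unfolding S_def using \<nu> by (subst sum_ennreal[symmetric]) (auto simp flip: ennreal_mult')
  also have "\<dots> \<le> (\<Sum>k. ennreal (1 / \<nu> ^ (2 * k)) * ennreal ((a k - a (Suc k))\<^sup>2))"
    by (intro sum_le_suminf) auto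
  finally have "ennreal S \<le> (\<Sum>k. ennreal (1 / \<nu> ^ (2 * k)) * ennreal ((a k - a (Suc k))\<^sup>2))" .
  moreover have "ennreal ((a N - a 0)\<^sup>2) \<le> ennreal (1 / (1 - \<nu>\<^sup>2)) * ennreal S"
    using * \<nu>2 by (simp add: ennreal_leI flip: ennreal_mult')
  ultimately show ?thesis by (meson mult_left_mono order.trans zero_le)
qed

text \<open>The chain \<open>p k w\<close> starts at the point x0 + (\<eta>/4) T w, which does not
  depend on \<open>x\<close>, and converges to \<open>x\<close>. Each link is estimated by the chain
  step after integration over \<open>w\<close>.\<close>

lemma John_curve_estimate:
  fixes f :: "'a::euclidean_space \<Rightarrow> real"
  assumes f: "segment_bound f H" and cont: "continuous_on UNIV f"
    and H [measurable]: "H \<in> borel_measurable borel"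
    and \<eta>: "0 < \<eta>" "\<eta> \<le> 1" and T: "0 < T"
    and \<nu>: "\<nu> = 1 - \<eta> / 16"
    and \<omega>: "\<omega> 0 = x" "\<omega> T = x0"
      "\<And>s t. 0 \<le> s \<Longrightarrow> s \<le> t \<Longrightarrow> t \<le> T \<Longrightarrow> dist (\<omega> s) (\<omega> t) \<le> t - s"
      "\<And>t. 0 < t \<Longrightarrow> t \<le> T \<Longrightarrow> ball (\<omega> t) (\<eta> * t) \<subseteq> X"
  shows "(\<integral>\<^sup>+w\<in>cball 0 1. ennreal ((f x - f (x0 + (\<eta> / 4 * T) *\<^sub>R w))\<^sup>2) \<partial>lborel)
    \<le> ennreal (1 / (1 - \<nu>\<^sup>2)) * (\<Sum>k. ennreal (\<nu> ^ (2 * k) * T * (4 / (\<eta> * (\<nu> ^ (4 * Suc k) * T))) ^ DIM('a)) *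
        (\<integral>\<^sup>+z\<in>X \<inter> cball x (2 * (\<nu> ^ (4 * k) * T)). H z \<partial>lborel))"
proof -
  have \<nu>01: "0 < \<nu>" "\<nu> < 1" using \<eta> \<nu> by auto
  \<comment> \<open>The ratio is \<nu>^4, not \<nu>, so that the scale outweighs the Cauchy--Schwarz
    weight \<nu>^(-2k) and still leaves a decaying factor \<nu>^(2k).\<close>
  define t where "t k = \<nu> ^ (4 * k) * T" for k
  define p where "p k w = \<omega> (t k) + (\<eta> / 4 * t k) *\<^sub>R w" for k w
  have t: "0 < t k" "t k \<le> T" for k
    using \<nu>01 T by (auto simp: t_def mult_le_cancel_right1 power_le_one)
  have tSuc: "t (Suc k) = \<nu> ^ 4 * t k" for k by (simp add: t_def power_add)
  have tle: "t (Suc k) \<le> t k" for k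
    unfolding tSuc using t[of k] \<nu>01 by (simp add: mult_le_cancel_right1 power_le_one)
  \<comment> \<open>Bernoulli's inequality explains \<nu> = 1 - \<eta>/16: the chain step requires
    successive scales to have ratio at least 1 - \<eta>/4.\<close>
  have "1 - \<eta> / 4 \<le> \<nu> ^ 4" using Bernoulli_inequality[of "- \<eta> / 16" 4] \<eta> by (simp add: \<nu>)
  then have tge: "(1 - \<eta> / 4) * t k \<le> t (Suc k)" for k
    unfolding tSuc using t[of k] by (intro mult_right_mono) auto
  have t_lim: "t \<longlonglongrightarrow> 0"
    unfolding t_def power_mult using \<nu>01
    by (intro tendsto_mult_left_zero LIMSEQ_power_zero) (simp add: power_less_one_iff)
  have p_lim: "(\<lambda>k. p k w) \<longlonglongrightarrow> x" for w
  proof -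
    have "(\<lambda>k. \<omega> (t k)) \<longlonglongrightarrow> x"
    proof (rule tendsto_dist_iff[THEN iffD2], rule tendsto_sandwich[OF _ _ tendsto_const t_lim])
      show "\<forall>\<^sub>F k in sequentially. dist (\<omega> (t k)) x \<le> t k"
        using \<omega>(3)[of 0 "t _"] t \<omega>(1) by (auto simp: dist_commute less_imp_le)
    qed auto
    moreover have "(\<lambda>k. (\<eta> / 4 * t k) *\<^sub>R w) \<longlonglongrightarrow> (\<eta> / 4 * 0) *\<^sub>R w"
      by (intro tendsto_intros t_lim)
    ultimately have "(\<lambda>k. p k w) \<longlonglongrightarrow> x + (\<eta> / 4 * 0) *\<^sub>R w"
      unfolding p_def by (rule tendsto_add)
    then show ?thesis by simp
  qed
  have [measurable]: "f \<in> borel_measurable borel" using cont by (rule borel_measurable_continuous_onI)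
  have [measurable]: "p k \<in> borel_measurable borel" for k unfolding p_def[abs_def] by measurable
  have [measurable]: "cball (0::'a) 1 \<in> sets borel" by simp
  define B where "B w = (\<Sum>k. ennreal (1 / \<nu> ^ (2 * k)) * ennreal ((f (p k w) - f (p (Suc k) w))\<^sup>2))" for w
  have pt: "ennreal ((f x - f (x0 + (\<eta> / 4 * T) *\<^sub>R w))\<^sup>2) \<le> ennreal (1 / (1 - \<nu>\<^sup>2)) * B w" for w
  proof (rule tendsto_upperbound)
    have "isCont f x" using cont by (simp add: continuous_on_eq_continuous_at)
    then have "(\<lambda>N. f (p N w)) \<longlonglongrightarrow> f x" using p_lim isCont_tendsto_compose by blast
    then show "(\<lambda>N. ennreal ((f (p N w) - f (p 0 w))\<^sup>2)) \<longlonglongrightarrow> ennreal ((f x - f (x0 + (\<eta> / 4 * T) *\<^sub>R w))\<^sup>2)"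
      using \<omega>(2) by (intro tendsto_intros) (auto simp: p_def t_def intro!: tendsto_eq_intros)
    show "\<forall>\<^sub>F N in sequentially. ennreal ((f (p N w) - f (p 0 w))\<^sup>2) \<le> ennreal (1 / (1 - \<nu>\<^sup>2)) * B w"
      unfolding B_def using geometric_Cauchy_Schwarz[OF \<nu>01, of "\<lambda>k. f (p k w)"] by auto
  qed simp
  have "(\<integral>\<^sup>+w\<in>cball 0 1. ennreal ((f x - f (x0 + (\<eta> / 4 * T) *\<^sub>R w))\<^sup>2) \<partial>lborel)
     \<le> (\<integral>\<^sup>+w. ennreal (1 / (1 - \<nu>\<^sup>2)) * (B w * indicator (cball 0 1) w) \<partial>lborel)"
    using pt by (intro nn_integral_mono) (auto simp: indicator_def)
  also have "\<dots> = ennreal (1 / (1 - \<nu>\<^sup>2)) * (\<integral>\<^sup>+w\<in>cball 0 1. B w \<partial>lborel)"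
    unfolding B_def by (intro nn_integral_cmult) measurable
  also have "(\<integral>\<^sup>+w\<in>cball 0 1. B w \<partial>lborel)
      = (\<Sum>k. (\<integral>\<^sup>+w. ennreal (1 / \<nu> ^ (2 * k)) * ennreal ((f (p k w) - f (p (Suc k) w))\<^sup>2) * indicator (cball 0 1) w \<partial>lborel))"
    unfolding B_def ennreal_suminf_multc[symmetric] by (intro nn_integral_suminf) measurable
  also have "\<dots> \<le> (\<Sum>k. ennreal (\<nu> ^ (2 * k) * T * (4 / (\<eta> * (\<nu> ^ (4 * Suc k) * T))) ^ DIM('a)) *
        (\<integral>\<^sup>+z\<in>X \<inter> cball x (2 * (\<nu> ^ (4 * k) * T)). H z \<partial>lborel))"
  proof (intro suminf_le summableI)
    fix k
    have "(\<integral>\<^sup>+w. ennreal (1 / \<nu> ^ (2 * k)) * ennreal ((f (p k w) - f (p (Suc k) w))\<^sup>2) * indicator (cball 0 1) w \<partial>lborel)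
       = ennreal (1 / \<nu> ^ (2 * k)) * (\<integral>\<^sup>+w\<in>cball 0 1. ennreal ((f (p k w) - f (p (Suc k) w))\<^sup>2) \<partial>lborel)"
      unfolding mult.assoc by (intro nn_integral_cmult) measurable
    also have "\<dots> \<le> ennreal (1 / \<nu> ^ (2 * k)) * (ennreal (t k * (4 / (\<eta> * t (Suc k))) ^ DIM('a)) *
        (\<integral>\<^sup>+z\<in>X \<inter> cball x (2 * t k). H z \<partial>lborel))"
    proof (intro mult_left_mono)
      show "(\<integral>\<^sup>+w\<in>cball 0 1. ennreal ((f (p k w) - f (p (Suc k) w))\<^sup>2) \<partial>lborel) \<le> ennreal (t k * (4 / (\<eta> * t (Suc k))) ^ DIM('a)) *
        (\<integral>\<^sup>+z\<in>X \<inter> cball x (2 * t k). H z \<partial>lborel)"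
        unfolding p_def
      proof (rule segment_bound_chain_step[OF f H \<eta>])
        show "0 < t (Suc k)" "t (Suc k) \<le> t k" "(1 - \<eta> / 4) * t k \<le> t (Suc k)" by (rule t tle tge)+
        show "ball (\<omega> (t k)) (\<eta> * t k) \<subseteq> X" using t by (intro \<omega>)
        show "dist x (\<omega> (t k)) \<le> t k" using \<omega>(3)[of 0 "t k"] t[of k] \<omega>(1) by simp
        show "dist (\<omega> (t k)) (\<omega> (t (Suc k))) \<le> t k - t (Suc k)"
          using \<omega>(3)[of "t (Suc k)" "t k"] t[of k] t[of "Suc k"] tle[of k] by (simp add: dist_commute)
      qed
    qed simp
    also have "\<dots> = ennreal (1 / \<nu> ^ (2 * k) * (t k * (4 / (\<eta> * t (Suc k))) ^ DIM('a))) *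
        (\<integral>\<^sup>+z\<in>X \<inter> cball x (2 * t k). H z \<partial>lborel)"
      using \<nu>01 by (subst ennreal_mult'[of "1 / \<nu> ^ (2 * k)"]) (auto simp: mult.assoc)
    also have "1 / \<nu> ^ (2 * k) * (t k * (4 / (\<eta> * t (Suc k))) ^ DIM('a))
        = \<nu> ^ (2 * k) * T * (4 / (\<eta> * t (Suc k))) ^ DIM('a)"
    proof -
      have "\<nu> ^ (4 * k) = \<nu> ^ (2 * k) * \<nu> ^ (2 * k)" by (simp flip: power_add)
      then show ?thesis using \<nu>01 by (simp add: t_def)
    qed
    finally show "(\<integral>\<^sup>+w. ennreal (1 / \<nu> ^ (2 * k)) * ennreal ((f (p k w) - f (p (Suc k) w))\<^sup>2) * indicator (cball 0 1) w \<partial>lborel)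
      \<le> ennreal (\<nu> ^ (2 * k) * T * (4 / (\<eta> * (\<nu> ^ (4 * Suc k) * T))) ^ DIM('a)) *
        (\<integral>\<^sup>+z\<in>X \<inter> cball x (2 * (\<nu> ^ (4 * k) * T)). H z \<partial>lborel)"
      unfolding t_def .
  qed
  finally show ?thesis by (simp add: mult_left_mono)
qed

text \<open>By Fubini each \<open>z\<close> is counted with the volume of the ball of radius
  \<open>r\<close> around it. This volume later compensates the Jacobian of the chain step.\<close>

lemma nn_integral_cball_average:
  fixes X :: "'a::euclidean_space set"
  assumes [measurable]: "H \<in> borel_measurable borel" "X \<in> sets borel" and r: "0 < r"
  shows "(\<integral>\<^sup>+x\<in>X. (\<integral>\<^sup>+z\<in>X \<inter> cball x r. H z \<partial>lborel) \<partial>lborel)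
     \<le> ennreal (r ^ DIM('a)) * emeasure lborel (cball (0::'a) 1) * (\<integral>\<^sup>+z\<in>X. H z \<partial>lborel)"
proof -
  have "(\<integral>\<^sup>+x\<in>X. (\<integral>\<^sup>+z\<in>X \<inter> cball x r. H z \<partial>lborel) \<partial>lborel)
      \<le> (\<integral>\<^sup>+x. (\<integral>\<^sup>+z. H z * indicator X z * indicator {..r} (dist x z) \<partial>lborel) \<partial>lborel)"
    by (intro nn_integral_mono) (auto simp: indicator_def intro!: nn_integral_mono)
  also have "\<dots> = (\<integral>\<^sup>+z. (\<integral>\<^sup>+x. H z * indicator X z * indicator {..r} (dist x z) \<partial>lborel) \<partial>lborel)"
    by (intro lborel_pair.Fubini') measurable
  also have "\<dots> = (\<integral>\<^sup>+z. H z * indicator X z * emeasure lborel (cball z r) \<partial>lborel)"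
  proof (intro nn_integral_cong)
    fix z :: 'a
    have "(\<integral>\<^sup>+x. H z * indicator X z * indicator {..r} (dist x z) \<partial>lborel)
        = H z * indicator X z * (\<integral>\<^sup>+x. indicator {..r} (dist x z) \<partial>lborel)"
      by (intro nn_integral_cmult) measurable
    also have "(\<integral>\<^sup>+x. indicator {..r} (dist x z) \<partial>lborel) = (\<integral>\<^sup>+x. indicator (cball z r) x \<partial>lborel)"
      by (intro nn_integral_cong) (auto simp: indicator_def dist_commute)
    finally show "(\<integral>\<^sup>+x. H z * indicator X z * indicator {..r} (dist x z) \<partial>lborel)
        = H z * indicator X z * emeasure lborel (cball z r)" by simp
  qed
  also have "\<dots> = (\<integral>\<^sup>+z. (ennreal (r ^ DIM('a)) * emeasure lborel (cball (0::'a) 1)) * (H z * indicator X z) \<partial>lborel)"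
    unfolding emeasure_lborel_cball_scale[OF r] by (simp add: mult_ac)
  also have "\<dots> = (ennreal (r ^ DIM('a)) * emeasure lborel (cball (0::'a) 1)) * (\<integral>\<^sup>+z\<in>X. H z \<partial>lborel)"
    by (intro nn_integral_cmult) measurable
  finally show ?thesis .
qed

text \<open>The comparison value f(x0 + (\<eta>/4) T w) depends on \<open>w\<close> but not on
  \<open>x\<close>. For each \<open>w\<close> it is an admissible \<open>a\<close>, so the infimum
  can be averaged over \<open>w\<close>.\<close>

theorem John_domain_segment_Poincare:
  fixes X :: "'a::euclidean_space set"
  assumes X: "John_domain X"
  shows "\<exists>C>0. \<forall>f H. continuous_on UNIV f \<longrightarrow> H \<in> borel_measurable borel \<longrightarrow> segment_bound f H \<longrightarrow>
    (INF a. \<integral>\<^sup>+x\<in>X. ennreal ((f x - a)\<^sup>2) \<partial>lborel) \<le> ennreal C * (\<integral>\<^sup>+x\<in>X. H x \<partial>lborel)"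
proof -
  obtain T \<eta> x0 where T: "0 < T" and \<eta>: "0 < \<eta>" "\<eta> \<le> 1" and curves:
    "\<And>x. x \<in> X \<Longrightarrow> \<exists>\<omega>. \<omega> 0 = x \<and> \<omega> T = x0 \<and>
       (\<forall>s t. 0 \<le> s \<longrightarrow> s \<le> t \<longrightarrow> t \<le> T \<longrightarrow> dist (\<omega> s) (\<omega> t) \<le> t - s) \<and>
       (\<forall>t. 0 < t \<longrightarrow> t \<le> T \<longrightarrow> ball (\<omega> t) (\<eta> * t) \<subseteq> X)"
    by (rule John_domain_uniform_curves[OF X]) (rule that, assumption+)
  define \<nu> where "\<nu> = 1 - \<eta> / 16"
  have \<nu>: "0 < \<nu>" "\<nu> < 1" using \<eta> by (auto simp: \<nu>_def)
  have \<nu>2: "\<nu>\<^sup>2 < 1" using \<nu> by (simp add: power_less_one_iff)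
  \<comment> \<open>What remains of the constant at scale \<open>k\<close> besides \<nu>^(2k): the
    product of 4 / (\<eta> \<nu>^(4(k+1)) T) from the Jacobian and the ball radius 2 \<nu>^(4k) T is
    8 / (\<eta> \<nu>^4), for every \<open>k\<close>.\<close>
  define A where "A = T * (8 / (\<eta> * \<nu> ^ 4)) ^ DIM('a)"
  \<comment> \<open>One geometric series comes from Cauchy--Schwarz, the other from summing over the
    scales.\<close>
  define C where "C = 1 / (1 - \<nu>\<^sup>2) * (A * (1 / (1 - \<nu>\<^sup>2)))"
  have A: "0 < A" using T \<eta> \<nu> by (simp add: A_def)
  have C: "0 < C" using A \<nu>2 by (simp add: C_def)
  define V where "V = emeasure lborel (cball (0::'a) 1)"
  have V: "V \<noteq> 0" "V < top"
  proof -
    show "V \<noteq> 0" using content_cball_pos[of 1 "0::'a"] by (auto simp: V_def measure_def)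
    show "V < top" unfolding V_def using emeasure_lborel_cball_finite by simp
  qed
  have [measurable]: "X \<in> sets borel" using X by (simp add: John_domain_def)
  have [measurable]: "cball (0::'a) 1 \<in> sets borel" by simp
  show ?thesis
  proof (intro exI[of _ C] conjI allI impI C)
    fix f :: "'a \<Rightarrow> real" and H :: "'a \<Rightarrow> ennreal"
    assume cont: "continuous_on UNIV f" and H [measurable]: "H \<in> borel_measurable borel"
      and f: "segment_bound f H"
    have [measurable]: "f \<in> borel_measurable borel" using cont by (rule borel_measurable_continuous_onI)
    define I where "I = (\<integral>\<^sup>+x\<in>X. H x \<partial>lborel)"
    define J where "J k x = (\<integral>\<^sup>+z\<in>X \<inter> cball x (2 * (\<nu> ^ (4 * k) * T)). H z \<partial>lborel)" for k x
    define m where "m = (INF a. \<integral>\<^sup>+x\<in>X. ennreal ((f x - a)\<^sup>2) \<partial>lborel)"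
    define c where "c k = \<nu> ^ (2 * k) * T * (4 / (\<eta> * (\<nu> ^ (4 * Suc k) * T))) ^ DIM('a)" for k
    have c0: "0 \<le> c k" for k using \<nu> T \<eta> by (simp add: c_def)
    have [measurable]: "J k \<in> borel_measurable borel" for k
    proof -
      have "J k = (\<lambda>x. \<integral>\<^sup>+z. H z * indicator X z * indicator {..2 * (\<nu> ^ (4 * k) * T)} (dist x z) \<partial>lborel)"
        unfolding J_def by (intro ext nn_integral_cong) (auto simp: indicator_def)
      also have "\<dots> \<in> borel_measurable borel" by measurable
      finally show ?thesis .
    qed
    have "m * V = (\<integral>\<^sup>+w\<in>cball (0::'a) 1. m \<partial>lborel)"
      by (simp add: V_def nn_integral_cmult)
    also have "\<dots> \<le> (\<integral>\<^sup>+w. (\<integral>\<^sup>+x. ennreal ((f x - f (x0 + (\<eta> / 4 * T) *\<^sub>R w))\<^sup>2) * indicator X x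
         * indicator (cball 0 1) w \<partial>lborel) \<partial>lborel)"
      by (intro nn_integral_mono) (auto simp: m_def indicator_def intro: INF_lower)
    also have "\<dots> = (\<integral>\<^sup>+x. (\<integral>\<^sup>+w. ennreal ((f x - f (x0 + (\<eta> / 4 * T) *\<^sub>R w))\<^sup>2) * indicator X x
         * indicator (cball 0 1) w \<partial>lborel) \<partial>lborel)"
      by (intro lborel_pair.Fubini') measurable
    also have "\<dots> \<le> (\<integral>\<^sup>+x. ennreal (1 / (1 - \<nu>\<^sup>2)) * (\<Sum>k. ennreal (c k) * (J k x * indicator X x)) \<partial>lborel)"
    proof (intro nn_integral_mono)
      fix x :: 'a
      show "(\<integral>\<^sup>+w. ennreal ((f x - f (x0 + (\<eta> / 4 * T) *\<^sub>R w))\<^sup>2) * indicator X x * indicator (cball 0 1) w \<partial>lborel)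
        \<le> ennreal (1 / (1 - \<nu>\<^sup>2)) * (\<Sum>k. ennreal (c k) * (J k x * indicator X x))"
      proof (cases "x \<in> X")
        case True
        then obtain \<omega> where \<omega>: "\<omega> 0 = x" "\<omega> T = x0"
          "\<And>s t. 0 \<le> s \<Longrightarrow> s \<le> t \<Longrightarrow> t \<le> T \<Longrightarrow> dist (\<omega> s) (\<omega> t) \<le> t - s"
          "\<And>t. 0 < t \<Longrightarrow> t \<le> T \<Longrightarrow> ball (\<omega> t) (\<eta> * t) \<subseteq> X"
          using curves[OF True] by auto
        show ?thesis
          using John_curve_estimate[OF f cont H \<eta> T \<nu>_def \<omega>] True by (simp add: c_def J_def)
      qed simp
    qed
    also have "\<dots> = ennreal (1 / (1 - \<nu>\<^sup>2)) * (\<integral>\<^sup>+x. (\<Sum>k. ennreal (c k) * (J k x * indicator X x)) \<partial>lborel)"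
      by (intro nn_integral_cmult) measurable
    also have "(\<integral>\<^sup>+x. (\<Sum>k. ennreal (c k) * (J k x * indicator X x)) \<partial>lborel)
        = (\<Sum>k. (\<integral>\<^sup>+x. ennreal (c k) * (J k x * indicator X x) \<partial>lborel))"
      by (intro nn_integral_suminf) measurable
    also have "\<dots> \<le> (\<Sum>k. ennreal (A * (\<nu>\<^sup>2) ^ k) * (V * I))"
    proof (intro suminf_le summableI)
      fix k
      have "(\<integral>\<^sup>+x. ennreal (c k) * (J k x * indicator X x) \<partial>lborel)
          = ennreal (c k) * (\<integral>\<^sup>+x\<in>X. J k x \<partial>lborel)"
        by (intro nn_integral_cmult) measurable
      also have "\<dots> \<le> ennreal (c k) * (ennreal ((2 * (\<nu> ^ (4 * k) * T)) ^ DIM('a)) * V * I)"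
        unfolding J_def V_def I_def using \<nu> T
        by (intro mult_left_mono nn_integral_cball_average) auto
      also have "\<dots> = ennreal (c k * (2 * (\<nu> ^ (4 * k) * T)) ^ DIM('a)) * (V * I)"
        using c0[of k] by (subst ennreal_mult'[of "c k"]) (auto simp: mult.assoc)
      also have "c k * (2 * (\<nu> ^ (4 * k) * T)) ^ DIM('a) = A * (\<nu>\<^sup>2) ^ k"
      proof -
        have "4 / (\<eta> * (\<nu> ^ (4 * Suc k) * T)) * (2 * (\<nu> ^ (4 * k) * T)) = 8 / (\<eta> * \<nu> ^ 4)"
          using \<nu> T \<eta> by (simp add: power_add field_simps)
        moreover have "c k * (2 * (\<nu> ^ (4 * k) * T)) ^ DIM('a)
          = \<nu> ^ (2 * k) * T * (4 / (\<eta> * (\<nu> ^ (4 * Suc k) * T)) * (2 * (\<nu> ^ (4 * k) * T))) ^ DIM('a)"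
          unfolding c_def power_mult_distrib[of "4 / _"] by (simp only: mult.assoc)
        ultimately show ?thesis by (simp only: A_def power_mult[of \<nu> 2 k, symmetric] mult_ac)
      qed
      finally show "(\<integral>\<^sup>+x. ennreal (c k) * (J k x * indicator X x) \<partial>lborel) \<le> ennreal (A * (\<nu>\<^sup>2) ^ k) * (V * I)" .
    qed
    also have "\<dots> = ennreal (A * (1 / (1 - \<nu>\<^sup>2))) * (V * I)"
    proof -
      have "(\<lambda>k. A * (\<nu>\<^sup>2) ^ k) sums (A * (1 / (1 - \<nu>\<^sup>2)))"
        using \<nu>2 by (intro sums_mult geometric_sums) simp
      then have "(\<Sum>k. ennreal (A * (\<nu>\<^sup>2) ^ k)) = ennreal (A * (1 / (1 - \<nu>\<^sup>2)))"
        using A by (intro suminf_ennreal_eq) auto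
      then show ?thesis by simp
    qed
    also have "ennreal (1 / (1 - \<nu>\<^sup>2)) * (ennreal (A * (1 / (1 - \<nu>\<^sup>2))) * (V * I)) = ennreal C * I * V"
      unfolding C_def using \<nu>2 by (subst ennreal_mult'[of "1 / (1 - \<nu>\<^sup>2)" "A * (1 / (1 - \<nu>\<^sup>2))"]) (auto simp: mult_ac)
    finally have "m * V \<le> ennreal C * I * V" by (simp add: mult_left_mono)
    \<comment> \<open>The volume \<open>V\<close> of the unit ball, which occurs on both sides, is
      cancelled; it is positive and finite.\<close>
    then show "m \<le> ennreal C * I"
      using V by (simp add: ennreal_mult_le_mult_iff mult.commute[of _ V])
  qed
qed

subsection \<open>Differentiability of conjugates\<close>

text \<open>Averaging the volume of \<open>A\<close> over its translates by \<open>te\<close>, \<open>t \<in> [0,1]\<close>, avoids a coordinate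
  decomposition of Lebesgue measure.\<close>

lemma null_sets_lborel_if_null_on_lines:
  fixes A :: "'a::euclidean_space set"
  assumes [measurable]: "A \<in> sets borel"
    and null: "\<And>x. emeasure lborel {t \<in> {0..1}. x + t *\<^sub>R e \<in> A} = 0"
  shows "A \<in> null_sets lborel"
proof -
  have "emeasure lborel A = (\<integral>\<^sup>+t\<in>{0..1::real}. emeasure lborel A \<partial>lborel)"
    by (simp add: nn_integral_cmult)
  also have "\<dots> = (\<integral>\<^sup>+t. \<integral>\<^sup>+x. indicator A (x + t *\<^sub>R e) * indicator {0..1} t \<partial>lborel \<partial>lborel)"
  proof (intro nn_integral_cong)
    fix t :: real
    have "emeasure lborel A = emeasure (distr lborel borel ((+) (t *\<^sub>R e))) A"
      by (simp only: lborel_distr_plus)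
    also have "\<dots> = (\<integral>\<^sup>+x. indicator A x \<partial>distr lborel borel ((+) (t *\<^sub>R e)))" by simp
    also have "\<dots> = (\<integral>\<^sup>+x. indicator A (x + t *\<^sub>R e) \<partial>lborel)"
      by (subst nn_integral_distr) (auto simp: add.commute)
    finally show "emeasure lborel A * indicator {0..1} t
        = (\<integral>\<^sup>+x. indicator A (x + t *\<^sub>R e) * indicator {0..1} t \<partial>lborel)"
      by (simp add: nn_integral_multc)
  qed
  also have "\<dots> = (\<integral>\<^sup>+x. \<integral>\<^sup>+t. indicator A (x + t *\<^sub>R e) * indicator {0..1} t \<partial>lborel \<partial>lborel)"
    by (intro lborel_pair.Fubini') measurable
  also have "\<dots> = (\<integral>\<^sup>+(x::'a). 0 \<partial>lborel)"
  proof (intro nn_integral_cong)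
    fix x :: 'a
    have "(\<integral>\<^sup>+t. indicator A (x + t *\<^sub>R e) * indicator {0..1} t \<partial>lborel)
       = (\<integral>\<^sup>+t. indicator {t \<in> {0..1}. x + t *\<^sub>R e \<in> A} t \<partial>lborel)"
      by (intro nn_integral_cong) (auto simp: indicator_def)
    also have "\<dots> = emeasure lborel {t \<in> {0..1}. x + t *\<^sub>R e \<in> A}"
      by (intro nn_integral_indicator) measurable
    finally show "(\<integral>\<^sup>+t. indicator A (x + t *\<^sub>R e) * indicator {0..1} t \<partial>lborel) = 0" by (simp only: null)
  qed
  finally show ?thesis by (auto simp: null_sets_def)
qed

text \<open>These are the points with a kink of size \<epsilon> in direction \<open>e\<close>. On a
  line the integral of the second difference is O(d^2), whereas the integrand is at least \<epsilon>
  d on the set. So the set has measure O(d) on the line for every d > 0, hence measure 0.\<close>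

lemma second_difference_null:
  fixes \<phi> :: "'a::euclidean_space \<Rightarrow> real"
  assumes lip: "\<And>x y. \<bar>\<phi> x - \<phi> y\<bar> \<le> R * dist x y"
    and convex: "\<And>x v. 0 \<le> \<phi> (x + v) - 2 * \<phi> x + \<phi> (x - v)"
    and \<epsilon>: "0 < \<epsilon>"
  shows "{x. \<forall>d>0. \<epsilon> * d \<le> \<phi> (x + d *\<^sub>R e) - 2 * \<phi> x + \<phi> (x - d *\<^sub>R e)} \<in> null_sets lborel"
    (is "?A \<in> _")
proof -
  have R: "0 \<le> R"
  proof -
    obtain b :: 'a where "b \<in> Basis" using nonempty_Basis by blast
    then show ?thesis using lip[of b 0] by simp
  qed
  have cont [continuous_intros]: "continuous_on S (\<lambda>x. \<phi> (h x))" if "continuous_on S h"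
    for S :: "'b::topological_space set" and h
    by (rule continuous_on_compose2[OF lipschitz_on_continuous_on[of R UNIV] that])
       (use lip R in \<open>auto simp: lipschitz_on_def dist_real_def\<close>)
  \<comment> \<open>An uncountable intersection, but of closed sets, hence Borel.\<close>
  have "?A = (\<Inter>d\<in>{0<..}. {x. \<epsilon> * d \<le> \<phi> (x + d *\<^sub>R e) - 2 * \<phi> x + \<phi> (x - d *\<^sub>R e)})" by auto
  also have "closed \<dots>" by (intro closed_INT ballI closed_Collect_le continuous_intros)
  finally have A [measurable]: "?A \<in> sets borel" by (rule borel_closed)
  show ?thesis
  proof (rule null_sets_lborel_if_null_on_lines[of _ e])
    fix x
    define S where "S = {t \<in> {0..1}. x + t *\<^sub>R e \<in> ?A}"
    have [measurable]: "S \<in> sets borel" unfolding S_def by measurable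
    define F where "F t = \<phi> (x + t *\<^sub>R e)" for t
    define L where "L = R * norm e"
    have F: "\<bar>F s - F t\<bar> \<le> L * \<bar>s - t\<bar>" for s t
    proof -
      have "x + s *\<^sub>R e - (x + t *\<^sub>R e) = (s - t) *\<^sub>R e" by (simp add: scaleR_diff_left)
      then show ?thesis using lip[of "x + s *\<^sub>R e" "x + t *\<^sub>R e"] by (simp add: F_def L_def dist_norm mult_ac)
    qed
    have cF [continuous_intros]: "continuous_on S (\<lambda>x. F (h x))" if "continuous_on S h" for S :: "real set" and h
      unfolding F_def by (intro continuous_intros that)
    have le: "ennreal \<epsilon> * emeasure lborel S \<le> ennreal (4 * L * d)" if d: "0 < d" for d
    proof -
      define k where "k t = F (t + d) - 2 * F t + F (t - d)" for t
      have k0: "0 \<le> k t" for t using convex[of "x + t *\<^sub>R e" "d *\<^sub>R e"]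
        by (simp add: k_def F_def algebra_simps)
      have "integral {0..1} k = integral {0..1} (\<lambda>t. (F (t + d) - F t) + (F (t + - d) - F t))"
        by (rule arg_cong2[where f=integral]) (auto simp: k_def)
      also have "\<dots> = integral {0..1} (\<lambda>t. F (t + d) - F t) + integral {0..1} (\<lambda>t. F (t + - d) - F t)"
        by (rule integral_add) (auto intro!: integrable_continuous_real continuous_intros)
      \<comment> \<open>The first-order terms of the shifts by d and -d cancel.\<close>
      also have "\<dots> \<le> 4 * L * d\<^sup>2"
        using shift_integral_bound[OF F, of d] shift_integral_bound[OF F, of "- d"]
        by (simp add: abs_le_iff)
      finally have k1: "integral {0..1} k \<le> 4 * L * d\<^sup>2" .
      have "ennreal (\<epsilon> * d) * emeasure lborel S = (\<integral>\<^sup>+t\<in>S. ennreal (\<epsilon> * d) \<partial>lborel)"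
        by (simp add: nn_integral_cmult)
      also have "\<dots> \<le> (\<integral>\<^sup>+t\<in>{0..1}. ennreal (k t) \<partial>lborel)"
      proof (intro nn_integral_mono)
        fix t
        have "\<epsilon> * d \<le> k t" if "t \<in> S"
          using that d by (auto simp: S_def k_def F_def algebra_simps)
        then show "ennreal (\<epsilon> * d) * indicator S t \<le> ennreal (k t) * indicator {0..1} t"
          by (auto simp: indicator_def ennreal_leI) (auto simp: S_def)
      qed
      also have "\<dots> = ennreal (integral {0..1} k)"
        unfolding k_def by (intro nn_integral_continuous_Icc continuous_intros k0[unfolded k_def])
      also have "\<dots> \<le> ennreal (4 * L * d\<^sup>2)" using k1 by (rule ennreal_leI)
      also have "\<dots> = ennreal d * ennreal (4 * L * d)"
        using d by (simp add: power2_eq_square mult_ac flip: ennreal_mult')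
      finally have "ennreal d * (ennreal \<epsilon> * emeasure lborel S) \<le> ennreal d * ennreal (4 * L * d)"
        using d \<epsilon> by (simp add: ennreal_mult' mult_ac)
      then show ?thesis using d by (simp add: ennreal_mult_le_mult_iff)
    qed
    have "ennreal \<epsilon> * emeasure lborel S \<le> 0"
    proof (rule tendsto_lowerbound)
      have "((\<lambda>d. ennreal (4 * L * d)) \<longlongrightarrow> ennreal (4 * L * 0)) (at_right 0)"
        by (intro tendsto_intros)
      then show "((\<lambda>d. ennreal (4 * L * d)) \<longlongrightarrow> 0) (at_right 0)" by simp
      show "\<forall>\<^sub>F d in at_right 0. ennreal \<epsilon> * emeasure lborel S \<le> ennreal (4 * L * d)"
        using eventually_at_right_less[of "0::real"] by eventually_elim (rule le)
    qed simp
    then show "emeasure lborel {t \<in> {0..1}. x + t *\<^sub>R e \<in> ?A} = 0"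
      using \<epsilon> by (simp add: S_def)
  qed measurable
qed

section \<open>Conjugates of functions on a compact set\<close>

context
  fixes Y :: "'a::euclidean_space set" and \<psi> :: "'a \<Rightarrow> real"
  assumes Y: "compact Y" "Y \<noteq> {}" and \<psi>: "\<psi> \<in> C_b Y"
begin

lemma conjugate_on_ge:
  assumes "y \<in> Y"
  shows "inner x y - \<psi> y \<le> conjugate_on Y \<psi> x"
proof -
  have "compact ((\<lambda>y. inner x y - \<psi> y) ` Y)"
    using \<psi> Y by (intro compact_continuous_image continuous_intros) (auto simp: C_b_def)
  then show ?thesis
    unfolding conjugate_on_def using assms
    by (intro cSUP_upper bounded_imp_bdd_above compact_imp_bounded)
qed

lemma conjugate_on_attained: "\<exists>y\<in>Y. conjugate_on Y \<psi> x = inner x y - \<psi> y"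
proof -
  have "continuous_on Y (\<lambda>y. inner x y - \<psi> y)"
    using \<psi> by (intro continuous_intros) (auto simp: C_b_def)
  from continuous_attains_sup[OF Y this]
  obtain y where "y \<in> Y" "\<forall>z\<in>Y. inner x z - \<psi> z \<le> inner x y - \<psi> y" by auto
  then have "conjugate_on Y \<psi> x = inner x y - \<psi> y"
    unfolding conjugate_on_def by (intro cSup_eq_maximum) auto
  with \<open>y \<in> Y\<close> show ?thesis ..
qed

text \<open>A maximiser at \<open>x\<close> is still a competitor at \<open>x + v\<close>.\<close>

lemma conjugate_on_subgradient:
  assumes "y \<in> Y" "conjugate_on Y \<psi> x = inner x y - \<psi> y"
  shows "conjugate_on Y \<psi> x + inner v y \<le> conjugate_on Y \<psi> (x + v)"
  using conjugate_on_ge[OF assms(1), of "x + v"] assms(2) by (simp add: inner_add_left)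

lemma conjugate_on_lipschitz:
  assumes R: "\<And>y. y \<in> Y \<Longrightarrow> norm y \<le> R"
  shows "\<bar>conjugate_on Y \<psi> x - conjugate_on Y \<psi> z\<bar> \<le> R * dist x z"
proof -
  have *: "conjugate_on Y \<psi> x - conjugate_on Y \<psi> z \<le> R * dist x z" for x z
  proof -
    obtain y where y: "y \<in> Y" "conjugate_on Y \<psi> x = inner x y - \<psi> y"
      using conjugate_on_attained by blast
    have "conjugate_on Y \<psi> x - conjugate_on Y \<psi> z \<le> inner (x - z) y"
      using conjugate_on_subgradient[OF y, of "z - x"] by (simp add: inner_diff_left)
    also have "\<dots> \<le> norm (x - z) * norm y" by (rule norm_cauchy_schwarz)
    also have "\<dots> \<le> norm (x - z) * R" by (intro mult_left_mono R y) auto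
    finally show ?thesis by (simp add: dist_norm mult.commute)
  qed
  show ?thesis using *[of x z] *[of z x] by (simp add: dist_commute abs_le_iff)
qed

lemma conjugate_on_continuous: "continuous_on S (conjugate_on Y \<psi>)"
proof -
  obtain R where R: "\<And>y. y \<in> Y \<Longrightarrow> norm y \<le> R"
    using compact_imp_bounded[OF Y(1)] by (auto simp: bounded_iff)
  have "0 \<le> R" using R Y(2) norm_ge_zero order_trans by blast
  then have "R-lipschitz_on S (conjugate_on Y \<psi>)"
    using conjugate_on_lipschitz[OF R] by (auto simp: lipschitz_on_def dist_real_def)
  then show ?thesis by (rule lipschitz_on_continuous_on)
qed

text \<open>Two distinct maximisers are two subgradients that differ in some coordinate
  \<open>i\<close>. They force a kink in direction \<open>i\<close>, and kinks larger than 1/(n+1)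
  in coordinate directions occupy countably many null sets.\<close>

lemma AE_conjugate_on_unique_maximizer:
  "AE x in lborel. \<exists>!y. y \<in> Y \<and> conjugate_on Y \<psi> x = inner x y - \<psi> y"
proof -
  obtain R where R: "\<And>y. y \<in> Y \<Longrightarrow> norm y \<le> R"
    using compact_imp_bounded[OF Y(1)] by (auto simp: bounded_iff)
  define A where "A i n = {x. \<forall>d>0. (1 / real (Suc n)) * d \<le> conjugate_on Y \<psi> (x + d *\<^sub>R i)
     - 2 * conjugate_on Y \<psi> x + conjugate_on Y \<psi> (x - d *\<^sub>R i)}" for i n
  have A: "A i n \<in> null_sets lborel" for i n
    unfolding A_def
  proof (rule second_difference_null[OF conjugate_on_lipschitz[OF R]])
    fix x v
    obtain y where y: "y \<in> Y" "conjugate_on Y \<psi> x = inner x y - \<psi> y"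
      using conjugate_on_attained by blast
    show "0 \<le> conjugate_on Y \<psi> (x + v) - 2 * conjugate_on Y \<psi> x + conjugate_on Y \<psi> (x - v)"
      using conjugate_on_subgradient[OF y, of v] conjugate_on_subgradient[OF y, of "- v"] by simp
  qed auto
  have "\<And>i. AE x in lborel. \<forall>n. x \<notin> A i n"
    using A AE_not_in by (subst AE_all_countable) blast
  then have "AE x in lborel. \<forall>i\<in>Basis. \<forall>n. x \<notin> A i n"
    by (subst AE_ball_countable) (auto intro: countable_finite)
  then show ?thesis
  proof eventually_elim
    fix x assume x: "\<forall>i\<in>Basis. \<forall>n. x \<notin> A i n"
    have unique: "inner y i \<le> inner y' i"
      if y: "y \<in> Y" "conjugate_on Y \<psi> x = inner x y - \<psi> y"
      and y': "y' \<in> Y" "conjugate_on Y \<psi> x = inner x y' - \<psi> y'"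
      and i: "i \<in> Basis" for y y' i
    proof (rule ccontr)
      assume "\<not> inner y i \<le> inner y' i"
      then obtain n where n: "1 / real (Suc n) < inner y i - inner y' i"
        using reals_Archimedean[of "inner y i - inner y' i"] by (auto simp: inverse_eq_divide)
      have "x \<in> A i n"
        unfolding A_def
      proof (intro CollectI allI impI)
        fix d :: real assume d: "0 < d"
        have "1 / real (Suc n) * d \<le> (inner y i - inner y' i) * d"
          using n d by (intro mult_right_mono) auto
        moreover have "conjugate_on Y \<psi> x + inner y i * d \<le> conjugate_on Y \<psi> (x + d *\<^sub>R i)"
          using conjugate_on_subgradient[OF y, of "d *\<^sub>R i"] by (simp add: inner_commute mult.commute)
        moreover have "conjugate_on Y \<psi> x - inner y' i * d \<le> conjugate_on Y \<psi> (x - d *\<^sub>R i)"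
          using conjugate_on_subgradient[OF y', of "- (d *\<^sub>R i)"] by (simp add: inner_commute mult.commute)
        ultimately show "1 / real (Suc n) * d \<le> conjugate_on Y \<psi> (x + d *\<^sub>R i)
            - 2 * conjugate_on Y \<psi> x + conjugate_on Y \<psi> (x - d *\<^sub>R i)"
          unfolding left_diff_distrib by linarith
      qed
      then show False using x i by blast
    qed
    obtain y where "y \<in> Y" "conjugate_on Y \<psi> x = inner x y - \<psi> y"
      using conjugate_on_attained by blast
    moreover have "y' = y''" if "y' \<in> Y" "conjugate_on Y \<psi> x = inner x y' - \<psi> y'"
      "y'' \<in> Y" "conjugate_on Y \<psi> x = inner x y'' - \<psi> y''" for y' y''
    proof (rule euclidean_eqI)
      fix i :: 'a assume "i \<in> Basis"
      then show "inner y' i = inner y'' i"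
        using unique[OF that(1-4)] unique[OF that(3,4,1,2)] by (meson order.antisym)
    qed
    ultimately show "\<exists>!y. y \<in> Y \<and> conjugate_on Y \<psi> x = inner x y - \<psi> y" by blast
  qed
qed

text \<open>By uniqueness and compactness, maximisers \<open>y'\<close> at points \<open>z\<close>
  near \<open>x\<close> are close to \<open>y\<close>. The two subgradient inequalities then put the
  linearisation error between 0 and the inner product of z - x with y' - y.\<close>

lemma GDERIV_conjugate_on:
  assumes y: "y \<in> Y" "conjugate_on Y \<psi> x = inner x y - \<psi> y"
    and unique: "\<And>z. z \<in> Y \<Longrightarrow> conjugate_on Y \<psi> x = inner x z - \<psi> z \<Longrightarrow> z = y"
  shows "GDERIV (conjugate_on Y \<psi>) x :> y"
  unfolding gderiv_def has_derivative_at_alt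
proof (intro conjI allI impI)
  show "bounded_linear (\<lambda>h. inner h y)" by (rule bounded_linear_inner_left)
  fix e :: real assume e: "0 < e"
  obtain R where R: "0 < R" "\<And>y. y \<in> Y \<Longrightarrow> norm y \<le> R"
    using compact_imp_bounded[OF Y(1)] by (auto simp: bounded_pos)
  note lip = conjugate_on_lipschitz[OF R(2)]
  \<comment> \<open>Away from \<open>y\<close> the supremum is missed by a uniform margin
    \<open>g\<close>.\<close>
  have "\<exists>g>0. \<forall>z\<in>Y - ball y e. inner x z - \<psi> z \<le> conjugate_on Y \<psi> x - g"
  proof (cases "Y - ball y e = {}")
    case False
    have "compact (Y - ball y e)" using Y(1) by (rule compact_diff) simp
    moreover have "continuous_on (Y - ball y e) (\<lambda>z. inner x z - \<psi> z)"
      using \<psi> by (intro continuous_intros) (auto simp: C_b_def intro: continuous_on_subset)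
    ultimately obtain z where z: "z \<in> Y - ball y e"
      "\<And>z'. z' \<in> Y - ball y e \<Longrightarrow> inner x z' - \<psi> z' \<le> inner x z - \<psi> z"
      using continuous_attains_sup[of "Y - ball y e" "\<lambda>z. inner x z - \<psi> z"] False by blast
    have "z \<noteq> y" using z(1) e by auto
    then have "inner x z - \<psi> z < conjugate_on Y \<psi> x"
      using conjugate_on_ge[of z x] unique[of z] z(1) by force
    then show ?thesis using z(2)
      by (intro exI[of _ "conjugate_on Y \<psi> x - (inner x z - \<psi> z)"]) auto
  qed (auto intro: exI[of _ 1])
  then obtain g where g: "0 < g" "\<And>z. z \<in> Y - ball y e \<Longrightarrow> inner x z - \<psi> z \<le> conjugate_on Y \<psi> x - g"
    by blast
  show "\<exists>d>0. \<forall>z. norm (z - x) < d \<longrightarrow>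
      norm (conjugate_on Y \<psi> z - conjugate_on Y \<psi> x - inner (z - x) y) \<le> e * norm (z - x)"
  \<comment> \<open>Moving from \<open>x\<close> to \<open>z\<close> changes the conjugate and the
    inner product with \<open>y'\<close> by at most R |z - x| each, together less than
    \<open>g\<close>. So \<open>y'\<close> cannot lie outside the ball around
    \<open>y\<close>.\<close>
  proof (intro exI[of _ "g / (2 * R)"] conjI allI impI)
    fix z assume z: "norm (z - x) < g / (2 * R)"
    obtain y' where y': "y' \<in> Y" "conjugate_on Y \<psi> z = inner z y' - \<psi> y'"
      using conjugate_on_attained by blast
    have small: "2 * (R * norm (z - x)) < g" using z R by (simp add: field_simps)
    have "y' \<in> ball y e"
    proof (rule ccontr)
      assume "y' \<notin> ball y e"
      then have "inner x y' - \<psi> y' \<le> conjugate_on Y \<psi> x - g" using g(2) y' by auto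
      moreover have "inner (z - x) y' \<le> R * norm (z - x)"
        using norm_cauchy_schwarz[of "z - x" y'] mult_right_mono[OF R(2)[OF y'(1)], of "norm (z - x)"]
        by (simp add: mult.commute)
      moreover have "conjugate_on Y \<psi> x - conjugate_on Y \<psi> z \<le> R * norm (z - x)"
        using lip[of x z] by (simp add: dist_norm norm_minus_commute abs_le_iff)
      ultimately show False using y'(2) small by (simp add: inner_diff_left)
    qed
    then have "norm (y' - y) \<le> e" by (simp add: dist_norm norm_minus_commute)
    have "0 \<le> conjugate_on Y \<psi> z - conjugate_on Y \<psi> x - inner (z - x) y"
      using conjugate_on_subgradient[OF y, of "z - x"] by simp
    moreover have "conjugate_on Y \<psi> z - conjugate_on Y \<psi> x - inner (z - x) y \<le> inner (z - x) (y' - y)"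
      using conjugate_on_subgradient[OF y', of "x - z"]
      by (simp add: inner_diff_left inner_diff_right)
    moreover have "inner (z - x) (y' - y) \<le> e * norm (z - x)"
      using norm_cauchy_schwarz[of "z - x" "y' - y"] mult_left_mono[OF \<open>norm (y' - y) \<le> e\<close>, of "norm (z - x)"]
      by (simp add: mult.commute)
    ultimately show "norm (conjugate_on Y \<psi> z - conjugate_on Y \<psi> x - inner (z - x) y) \<le> e * norm (z - x)"
      by simp
  qed (use g R in auto)
qed

end

section \<open>The gradient as a measurable function\<close>

lemma grad_eqI:
  assumes "GDERIV f x :> D"
  shows "grad f x = D"
proof -
  have "D' = D" if "GDERIV f x :> D'" for D'
  proof -
    have "(\<lambda>h. inner h D') = (\<lambda>h. inner h D)"
      using that assms unfolding gderiv_def by (rule has_derivative_unique)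
    then have "inner (D' - D) D' = inner (D' - D) D" by metis
    then have "inner (D' - D) (D' - D) = 0" by (simp add: inner_diff_right)
    then show ?thesis by simp
  qed
  then have "(THE D. GDERIV f x :> D) = D" using assms by blast
  moreover have "f differentiable (at x)" using assms by (auto simp: gderiv_def differentiable_def)
  ultimately show ?thesis by (simp add: grad_def)
qed

text \<open>Restricting to the increments 1/(n+1) presents directional derivatives as limits of
  sequences, which preserve measurability.\<close>

lemma GDERIV_difference_quotient:
  assumes "GDERIV f x :> D"
  shows "(\<lambda>n. (f (x + (1 / real (Suc n)) *\<^sub>R v) - f x) / (1 / real (Suc n))) \<longlonglongrightarrow> inner v D"
proof -
  have "((\<lambda>t. f (x + t *\<^sub>R v)) has_derivative (\<lambda>t. inner (t *\<^sub>R v) D)) (at 0)"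
    by (rule has_derivative_compose[where f="\<lambda>t. x + t *\<^sub>R v"])
       (use assms in \<open>auto simp: gderiv_def intro!: derivative_eq_intros\<close>)
  then have "((\<lambda>t. f (x + t *\<^sub>R v)) has_real_derivative inner v D) (at 0)"
    by (simp add: has_field_derivative_def mult.commute[of _ "inner v D"])
  then have *: "((\<lambda>h. (f (x + h *\<^sub>R v) - f x) / h) \<longlongrightarrow> inner v D) (at 0)"
    by (simp add: DERIV_def)
  have "filterlim (\<lambda>n. 1 / real (Suc n)) (at 0) sequentially"
    unfolding filterlim_at using LIMSEQ_Suc[OF lim_1_over_n] by auto
  from filterlim_compose[OF * this] show ?thesis .
qed

lemma borel_measurable_grad:
  fixes f :: "'a::euclidean_space \<Rightarrow> real"
  assumes cont: "continuous_on UNIV f" and ae: "AE x in lebesgue. \<exists>D. GDERIV f x :> D"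
  shows "grad f \<in> borel_measurable lebesgue"
proof (rule borel_measurable_AE)
  have [measurable]: "f \<in> borel_measurable borel" using cont by (rule borel_measurable_continuous_onI)
  \<comment> \<open>Where the limits do not exist \<open>lim\<close> has an unspecified value, but
    \<open>G\<close> is still Borel and agrees with the gradient almost everywhere.\<close>
  define G where "G x = (\<Sum>i\<in>Basis. lim (\<lambda>n. (f (x + (1 / real (Suc n)) *\<^sub>R i) - f x) / (1 / real (Suc n))) *\<^sub>R i)" for x
  have "G \<in> borel_measurable borel" unfolding G_def[abs_def] by measurable
  then show "G \<in> borel_measurable lebesgue" by (intro measurable_completion) simp
  show "AE x in lebesgue. G x = grad f x"
    using ae
  proof eventually_elim
    case (elim x)
    then obtain D where D: "GDERIV f x :> D" by blast
    have "G x = (\<Sum>i\<in>Basis. inner D i *\<^sub>R i)"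
      unfolding G_def limI[OF GDERIV_difference_quotient[OF D]] inner_commute[of D] ..
    then show ?case by (simp add: euclidean_representation grad_eqI[OF D])
  qed
qed

subsection \<open>The variance inequality\<close>

text \<open>Passes between \<rho> and Lebesgue measure: the lower bound is applied to the gap, the
  upper bound to the second moment.\<close>

lemma nn_integral_density_on_bounds:
  fixes X :: "'a::euclidean_space set"
  assumes X: "X \<in> sets borel" and \<rho> [measurable]: "\<rho> \<in> borel_measurable (lebesgue_on X)"
    and bounds: "AE x in lebesgue_on X. m \<le> \<rho> x \<and> \<rho> x \<le> M" and m: "0 < m" and M: "0 < M"
    and u: "u \<in> borel_measurable borel"
  shows "ennreal m * (\<integral>\<^sup>+x\<in>X. u x \<partial>lborel) \<le> (\<integral>\<^sup>+x. u x \<partial>density_on X \<rho>)"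
    and "ennreal (1 / M) * (\<integral>\<^sup>+x. u x \<partial>density_on X \<rho>) \<le> (\<integral>\<^sup>+x\<in>X. u x \<partial>lborel)"
proof -
  have X': "X \<inter> space lebesgue \<in> sets lebesgue" using X by simp
  have [measurable]: "u \<in> borel_measurable (lebesgue_on X)"
    using u by (intro measurable_restrict_space1 measurable_completion) simp
  have eq: "(\<integral>\<^sup>+x. u x \<partial>density_on X \<rho>) = (\<integral>\<^sup>+x. ennreal (\<rho> x) * u x \<partial>lebesgue_on X)"
    unfolding density_on_def by (intro nn_integral_density) measurable
  have eq': "(\<integral>\<^sup>+x\<in>X. u x \<partial>lborel) = (\<integral>\<^sup>+x. u x \<partial>lebesgue_on X)"
    using nn_integral_restrict_space[OF X'] by (simp add: nn_integral_completion)
  have "ennreal m * (\<integral>\<^sup>+x. u x \<partial>lebesgue_on X) = (\<integral>\<^sup>+x. ennreal m * u x \<partial>lebesgue_on X)"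
    by (intro nn_integral_cmult[symmetric]) measurable
  also have "\<dots> \<le> (\<integral>\<^sup>+x. ennreal (\<rho> x) * u x \<partial>lebesgue_on X)"
    by (intro nn_integral_mono_AE eventually_mono[OF bounds]) (auto intro!: mult_right_mono ennreal_leI)
  finally show "ennreal m * (\<integral>\<^sup>+x\<in>X. u x \<partial>lborel) \<le> (\<integral>\<^sup>+x. u x \<partial>density_on X \<rho>)"
    by (simp only: eq eq')
  have "(\<integral>\<^sup>+x. ennreal (\<rho> x) * u x \<partial>lebesgue_on X) \<le> (\<integral>\<^sup>+x. ennreal M * u x \<partial>lebesgue_on X)"
    by (intro nn_integral_mono_AE eventually_mono[OF bounds]) (auto intro!: mult_right_mono ennreal_leI)
  also have "\<dots> = ennreal M * (\<integral>\<^sup>+x. u x \<partial>lebesgue_on X)"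
    by (intro nn_integral_cmult) measurable
  finally have "ennreal (1 / M) * (\<integral>\<^sup>+x. ennreal (\<rho> x) * u x \<partial>lebesgue_on X)
      \<le> ennreal (1 / M) * (ennreal M * (\<integral>\<^sup>+x. u x \<partial>lebesgue_on X))"
    by (rule mult_left_mono) simp
  also have "\<dots> = (\<integral>\<^sup>+x. u x \<partial>lebesgue_on X)"
    using M by (simp add: mult.assoc[symmetric] flip: ennreal_mult')
  finally show "ennreal (1 / M) * (\<integral>\<^sup>+x. u x \<partial>density_on X \<rho>) \<le> (\<integral>\<^sup>+x\<in>X. u x \<partial>lborel)"
    by (simp only: eq eq')
qed

text \<open>The mean minimises the second moment, so the unspecified constant in the Poincare
  inequality does no harm.\<close>

lemma (in prob_space) Var_le_second_moment:
  assumes f: "integrable M f" and f2: "integrable M (\<lambda>x. (f x)\<^sup>2)"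
  shows "integrable M (\<lambda>x. (f x - a)\<^sup>2)" and "Var M f \<le> (LINT x|M. (f x - a)\<^sup>2)"
proof -
  have eq: "(\<lambda>x. (f x - a)\<^sup>2) = (\<lambda>x. (f x)\<^sup>2 - 2 * a * f x + a\<^sup>2)"
    by (auto simp: power2_eq_square algebra_simps)
  show "integrable M (\<lambda>x. (f x - a)\<^sup>2)" unfolding eq using f f2 by simp
  have "(LINT x|M. (f x - a)\<^sup>2) = (LINT x|M. (f x)\<^sup>2) - 2 * a * (LINT x|M. f x) + a\<^sup>2"
    unfolding eq using f f2 by (simp add: prob_space)
  moreover have "0 \<le> ((LINT x|M. f x) - a)\<^sup>2" by simp
  ultimately show "Var M f \<le> (LINT x|M. (f x - a)\<^sup>2)"
    by (simp add: Var_def power2_eq_square algebra_simps)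
qed

section \<open>The lower bound for the Fenchel--Young gap\<close>

text \<open>A supremum of continuous functions, hence Borel and defined everywhere, whereas the gap itself
  is controlled only where the gradient exists.\<close>

definition gap_minorant :: "('a::euclidean_space \<Rightarrow> real) \<Rightarrow> ('a \<Rightarrow> real) \<Rightarrow> 'a \<Rightarrow> ennreal" where
  "gap_minorant f g x = (SUP v. ennreal (g x - g (x - v) - f (x + v) + f x))"

text \<open>The supremum runs over uncountably many \<open>v\<close>, so the argument is lower
  semicontinuity: strict superlevel sets are unions of open sets.\<close>

lemma borel_measurable_gap_minorant:
  fixes f g :: "'a::euclidean_space \<Rightarrow> real"
  assumes f: "continuous_on UNIV f" and g: "continuous_on UNIV g"
  shows "gap_minorant f g \<in> borel_measurable borel"
proof (rule borel_measurableI_greater)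
  fix y :: ennreal
  have "{x \<in> space borel. y < gap_minorant f g x} = (\<Union>v. {x. y < ennreal (g x - g (x - v) - f (x + v) + f x)})"
    by (auto simp: gap_minorant_def less_SUP_iff)
  also have "open \<dots>"
    by (intro open_UN ballI open_Collect_less continuous_intros continuous_on_ennreal
        continuous_on_compose2[OF f] continuous_on_compose2[OF g]) auto
  finally show "{x \<in> space borel. y < gap_minorant f g x} \<in> sets borel" by simp
qed

lemma segment_bound_gap_minorant:
  fixes f g :: "'a::euclidean_space \<Rightarrow> real"
  assumes R: "0 < R"
    and f: "\<And>x y. \<bar>f x - f y\<bar> \<le> R * dist x y" and g: "\<And>x y. \<bar>g x - g y\<bar> \<le> R * dist x y"
    and meas [measurable]: "gap_minorant f g \<in> borel_measurable borel"
  shows "segment_bound (\<lambda>x. g x - f x) (\<lambda>x. ennreal (16 * R) * gap_minorant f g x)"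
  unfolding segment_bound_def
proof (intro allI)
  fix p q
  have "ennreal (((g p - f p) - (g q - f q))\<^sup>2)
      \<le> ennreal (16 * R * dist p q) * (\<integral>\<^sup>+s\<in>{0..1}. gap_minorant f g (p + s *\<^sub>R (q - p)) \<partial>lborel)"
    by (intro segment_inequality R f g) (auto simp: gap_minorant_def intro: SUP_upper)
  also have "\<dots> = ennreal (dist p q) * (ennreal (16 * R) * (\<integral>\<^sup>+s\<in>{0..1}. gap_minorant f g (p + s *\<^sub>R (q - p)) \<partial>lborel))"
    using R by (simp add: ennreal_mult' mult_ac)
  also have "ennreal (16 * R) * (\<integral>\<^sup>+s\<in>{0..1}. gap_minorant f g (p + s *\<^sub>R (q - p)) \<partial>lborel)
      = (\<integral>\<^sup>+s\<in>{0..1}. ennreal (16 * R) * gap_minorant f g (p + s *\<^sub>R (q - p)) \<partial>lborel)"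
    unfolding mult.assoc by (intro nn_integral_cmult[symmetric]) measurable
  finally show "ennreal (((g p - f p) - (g q - f q))\<^sup>2)
      \<le> ennreal (dist p q) * (\<integral>\<^sup>+s\<in>{0..1}. ennreal (16 * R) * gap_minorant f g (p + s *\<^sub>R (q - p)) \<partial>lborel)" .
qed

text \<open>Bound \<phi>0(x + v) below by the subgradient \<open>y\<close> and \<phi>1(x - v) below
  by the competitor \<open>y\<close>; the two terms in \<open>v\<close> cancel.\<close>

lemma gap_minorant_conjugate_le:
  fixes Y :: "'a::euclidean_space set"
  assumes Y: "compact Y" "Y \<noteq> {}" and \<psi>: "\<psi>0 \<in> C_b Y" "\<psi>1 \<in> C_b Y"
    and y: "y \<in> Y" "conjugate_on Y \<psi>0 x = inner x y - \<psi>0 y"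
  shows "gap_minorant (conjugate_on Y \<psi>0) (conjugate_on Y \<psi>1) x
    \<le> ennreal (conjugate_on Y \<psi>1 x - conjugate_on Y \<psi>0 x + (\<psi>1 y - \<psi>0 y))"
  unfolding gap_minorant_def
proof (intro SUP_least ennreal_leI)
  fix v
  show "conjugate_on Y \<psi>1 x - conjugate_on Y \<psi>1 (x - v) - conjugate_on Y \<psi>0 (x + v) + conjugate_on Y \<psi>0 x
    \<le> conjugate_on Y \<psi>1 x - conjugate_on Y \<psi>0 x + (\<psi>1 y - \<psi>0 y)"
    using conjugate_on_subgradient[OF Y \<psi>(1) y, of v] conjugate_on_ge[OF Y \<psi>(2) y(1), of "x - v"] y(2)
    by (simp add: inner_diff_left)
qed

lemma AE_lborel_imp_AE_density_on:
  assumes "AE x in lborel. Q x" and X: "X \<in> sets borel"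
    and [measurable]: "\<rho> \<in> borel_measurable (lebesgue_on X)"
  shows "AE x in density_on X \<rho>. Q x"
proof -
  have "AE x in lebesgue. Q x" using assms(1) by (rule AE_completion)
  then have "AE x in lebesgue_on X. Q x"
    using X by (subst AE_restrict_space_iff) auto
  then show ?thesis unfolding density_on_def by (subst AE_density) auto
qed

theorem theorem2p8:
  fixes X :: "'a::euclidean_space set" and \<rho> :: "'a \<Rightarrow> real"
  assumes "John_domain X" and "interior X \<noteq> {}"
    and "prob_density_on X \<rho>"
    and "\<exists>m>0. \<exists>M>0. AE x in lebesgue_on X. m \<le> \<rho> x \<and> \<rho> x \<le> M"
  shows "\<forall>Y :: 'a set. compact Y \<and> Y \<noteq> {} \<longrightarrow>
    (\<exists>C>0. \<forall>\<psi>0\<in>C_b Y. \<forall>\<psi>1\<in>C_b Y.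
       Var (density_on X \<rho>) (\<lambda>x. conjugate_on Y \<psi>1 x - conjugate_on Y \<psi>0 x)
       \<le> C * (Kantorovich X \<rho> Y \<psi>1 - Kantorovich X \<rho> Y \<psi>0 +
              (LINT y:Y|distr (density_on X \<rho>) borel (grad (conjugate_on Y \<psi>0)). \<psi>1 y - \<psi>0 y)))"
proof (intro allI impI, elim conjE)
  fix Y :: "'a set" assume Y: "compact Y" "Y \<noteq> {}"
  have X: "bounded X" "X \<in> sets borel" using assms(1) by (auto simp: John_domain_def)
  have \<rho> [measurable]: "\<rho> \<in> borel_measurable (lebesgue_on X)"
    using assms(3) by (simp add: prob_density_on_def)
  obtain m M where mM: "0 < m" "0 < M" and bounds: "AE x in lebesgue_on X. m \<le> \<rho> x \<and> \<rho> x \<le> M"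
    using assms(4) by blast
  note dens = nn_integral_density_on_bounds[OF X(2) \<rho> bounds mM]
  obtain C0 where C0: "0 < C0" and poincare: "\<And>f H. continuous_on UNIV f \<Longrightarrow> H \<in> borel_measurable borel \<Longrightarrow>
    segment_bound f H \<Longrightarrow>
    (INF a. \<integral>\<^sup>+x\<in>X. ennreal ((f x - a)\<^sup>2) \<partial>lborel) \<le> ennreal C0 * (\<integral>\<^sup>+x\<in>X. H x \<partial>lborel)"
    using John_domain_segment_Poincare[OF assms(1)] by blast
  obtain R where R: "0 < R" "\<And>y. y \<in> Y \<Longrightarrow> norm y \<le> R"
    using compact_imp_bounded[OF Y(1)] by (auto simp: bounded_pos)
  define P where "P = density_on X \<rho>"
  interpret P: prob_space P using assms(3) by (simp add: prob_density_on_def P_def)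
  have sets_P: "sets P = sets (lebesgue_on X)" and space_P: "space P = X"
    by (simp_all add: P_def density_on_def space_restrict_space)
  have meas_P: "u \<in> borel_measurable P" if "u \<in> borel_measurable lebesgue" for u :: "'a \<Rightarrow> 'b::topological_space"
    using measurable_restrict_space1[OF that, of X] by (simp add: measurable_cong_sets[OF sets_P refl])
  have meas_P': "u \<in> borel_measurable P" if "u \<in> borel_measurable borel" for u :: "'a \<Rightarrow> real"
    using that by (intro meas_P measurable_completion) simp
  have int_cont: "integrable P u" if u: "continuous_on UNIV u" for u :: "'a \<Rightarrow> real"
  proof -
    \<comment> \<open>A continuous function is bounded on the compact closure of \<open>X\<close>,
      hence integrable for a probability measure on \<open>X\<close>.\<close>
    have "compact (u ` closure X)"
      using X(1) u by (intro compact_continuous_image continuous_on_subset[OF u]) auto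
    then have "bounded (u ` closure X)" by (rule compact_imp_bounded)
    then obtain B where "\<forall>y\<in>u ` closure X. norm y \<le> B" unfolding bounded_iff ..
    then have B: "norm (u x) \<le> B" if "x \<in> closure X" for x using that by blast
    show ?thesis
      using B closure_subset[of X] u
      by (intro P.integrable_const_bound[of _ B] meas_P' borel_measurable_continuous_onI)
         (auto intro!: AE_I2 simp: space_P)
  qed
  show "\<exists>C>0. \<forall>\<psi>0\<in>C_b Y. \<forall>\<psi>1\<in>C_b Y.
       Var (density_on X \<rho>) (\<lambda>x. conjugate_on Y \<psi>1 x - conjugate_on Y \<psi>0 x)
       \<le> C * (Kantorovich X \<rho> Y \<psi>1 - Kantorovich X \<rho> Y \<psi>0 +
              (LINT y:Y|distr (density_on X \<rho>) borel (grad (conjugate_on Y \<psi>0)). \<psi>1 y - \<psi>0 y))"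
    unfolding P_def[symmetric]
  \<comment> \<open>\<open>M\<close> and \<open>1 / m\<close> compare \<rho> with Lebesgue measure,
    \<open>C0\<close> is the Poincare constant of \<open>X\<close>, and \<open>16 * R\<close> comes
    from the segment inequality, with \<open>R\<close> a bound for \<open>Y\<close>. All are fixed
    before \<psi>0 and \<psi>1.\<close>
  proof (intro exI[of _ "M * (C0 * (16 * R)) / m"] conjI ballI)
    show "0 < M * (C0 * (16 * R)) / m" using mM C0 R by simp
    fix \<psi>0 \<psi>1 assume \<psi>: "\<psi>0 \<in> C_b Y" "\<psi>1 \<in> C_b Y"
    define \<phi>0 where "\<phi>0 = conjugate_on Y \<psi>0"
    define \<phi>1 where "\<phi>1 = conjugate_on Y \<psi>1"
    have cont: "continuous_on UNIV \<phi>0" "continuous_on UNIV \<phi>1"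
      unfolding \<phi>0_def \<phi>1_def by (intro conjugate_on_continuous Y \<psi>)+
    have lip: "\<bar>\<phi>0 x - \<phi>0 y\<bar> \<le> R * dist x y" "\<bar>\<phi>1 x - \<phi>1 y\<bar> \<le> R * dist x y" for x y
      unfolding \<phi>0_def \<phi>1_def by (intro conjugate_on_lipschitz Y \<psi> R; assumption)+
    define f where "f x = \<phi>1 x - \<phi>0 x" for x
    have cont_f: "continuous_on UNIV f" unfolding f_def by (intro continuous_intros cont)
    define H where "H = gap_minorant \<phi>0 \<phi>1"
    have H [measurable]: "H \<in> borel_measurable borel"
      unfolding H_def by (rule borel_measurable_gap_minorant[OF cont])
    \<comment> \<open>Extension by 0 from \<open>Y\<close>, which makes the integrand Borel whatever
      the values of \<psi>0 and \<psi>1 outside \<open>Y\<close>.\<close>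
    define u where "u y = indicat_real Y y *\<^sub>R (\<psi>1 y - \<psi>0 y)" for y
    \<comment> \<open>Where the maximiser is unique this is the Fenchel--Young gap at the gradient
      of \<phi>0.\<close>
    define h where "h x = f x + u (grad \<phi>0 x)" for x
    have u [measurable]: "u \<in> borel_measurable borel"
      unfolding u_def[abs_def] using \<psi> compact_imp_closed[OF Y(1)]
      by (intro borel_measurable_continuous_on_indicator continuous_intros) (auto simp: C_b_def)
    have ae: "AE x in lborel. GDERIV \<phi>0 x :> grad \<phi>0 x \<and> H x \<le> ennreal (h x) \<and> 0 \<le> h x"
      using AE_conjugate_on_unique_maximizer[OF Y \<psi>(1)]
    proof eventually_elim
      case (elim x)
      then obtain y where y: "y \<in> Y" "conjugate_on Y \<psi>0 x = inner x y - \<psi>0 y"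
        and unique: "\<And>z. z \<in> Y \<Longrightarrow> conjugate_on Y \<psi>0 x = inner x z - \<psi>0 z \<Longrightarrow> z = y" by blast
      have "GDERIV \<phi>0 x :> y" unfolding \<phi>0_def by (rule GDERIV_conjugate_on[OF Y \<psi>(1) y unique])
      moreover from this have "grad \<phi>0 x = y" by (rule grad_eqI)
      moreover have "H x \<le> ennreal (\<phi>1 x - \<phi>0 x + (\<psi>1 y - \<psi>0 y))"
        unfolding H_def \<phi>0_def \<phi>1_def by (rule gap_minorant_conjugate_le[OF Y \<psi> y])
      moreover have "0 \<le> \<phi>1 x - \<phi>0 x + (\<psi>1 y - \<psi>0 y)"
        using conjugate_on_ge[OF Y \<psi>(2) y(1), of x] y(2) by (simp add: \<phi>0_def \<phi>1_def)
      ultimately show ?case using y(1) by (simp add: h_def f_def u_def)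
    qed
    have ae_P: "AE x in P. H x \<le> ennreal (h x) \<and> 0 \<le> h x"
      unfolding P_def using ae by (intro AE_lborel_imp_AE_density_on X \<rho>) auto
    have grad [measurable]: "grad \<phi>0 \<in> borel_measurable P"
    proof (intro meas_P borel_measurable_grad cont)
      show "AE x in lebesgue. \<exists>D. GDERIV \<phi>0 x :> D"
        using AE_completion[OF ae] by eventually_elim blast
    qed
    have int_u: "integrable P (\<lambda>x. u (grad \<phi>0 x))"
    proof -
      obtain B0 B1 where "\<And>y. y \<in> Y \<Longrightarrow> norm (\<psi>0 y) \<le> B0" "\<And>y. y \<in> Y \<Longrightarrow> norm (\<psi>1 y) \<le> B1"
        using \<psi> by (auto simp: C_b_def bounded_iff)
      then have "norm (u y) \<le> \<bar>B1\<bar> + \<bar>B0\<bar>" for y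
        by (cases "y \<in> Y") (fastforce simp: u_def)+
      then show ?thesis by (intro P.integrable_const_bound[of _ "\<bar>B1\<bar> + \<bar>B0\<bar>"]) auto
    qed
    have int_f: "integrable P f" by (rule int_cont[OF cont_f])
    have int_f2: "integrable P (\<lambda>x. (f x)\<^sup>2)" by (intro int_cont continuous_intros cont_f)
    define E where "E = (LINT x|P. h x)"
    have E: "Kantorovich X \<rho> Y \<psi>1 - Kantorovich X \<rho> Y \<psi>0 +
              (LINT y:Y|distr P borel (grad (conjugate_on Y \<psi>0)). \<psi>1 y - \<psi>0 y) = E"
    proof -
      have "(LINT y:Y|distr P borel (grad \<phi>0). \<psi>1 y - \<psi>0 y) = (LINT x|P. u (grad \<phi>0 x))"
        unfolding set_lebesgue_integral_def u_def[symmetric] by (intro integral_distr) measurable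
      moreover have "E = (LINT x|P. f x) + (LINT x|P. u (grad \<phi>0 x))"
        unfolding E_def h_def by (intro Bochner_Integration.integral_add int_f int_u)
      moreover have "(LINT x|P. f x) = (LINT x|P. \<phi>1 x) - (LINT x|P. \<phi>0 x)"
        unfolding f_def by (intro Bochner_Integration.integral_diff int_cont cont)
      ultimately show ?thesis by (simp add: Kantorovich_def P_def \<phi>0_def \<phi>1_def)
    qed
    have int_h: "integrable P h" unfolding h_def using int_f int_u by simp
    \<comment> \<open>Without the sign, the final inequality in \<open>ennreal\<close> could not be
      read back as one between reals.\<close>
    have E0: "0 \<le> E" unfolding E_def using ae_P by (intro integral_nonneg_AE) auto
    have HE: "ennreal m * (\<integral>\<^sup>+x\<in>X. H x \<partial>lborel) \<le> ennreal E"
    proof -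
      have "ennreal m * (\<integral>\<^sup>+x\<in>X. H x \<partial>lborel) \<le> (\<integral>\<^sup>+x. H x \<partial>P)" unfolding P_def by (rule dens(1)[OF H])
      also have "\<dots> \<le> (\<integral>\<^sup>+x. ennreal (h x) \<partial>P)" using ae_P by (intro nn_integral_mono_AE) auto
      also have "\<dots> = ennreal E" unfolding E_def using ae_P by (intro nn_integral_eq_integral int_h) auto
      finally show ?thesis .
    qed
    have "ennreal (Var P f / M) \<le> (INF a. \<integral>\<^sup>+x\<in>X. ennreal ((f x - a)\<^sup>2) \<partial>lborel)"
    proof (rule INF_greatest)
      fix a
      have "ennreal (Var P f / M) \<le> ennreal (1 / M * (LINT x|P. (f x - a)\<^sup>2))"
        using P.Var_le_second_moment(2)[OF int_f int_f2, of a] mM(2)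
        by (intro ennreal_leI) (simp add: divide_right_mono)
      also have "\<dots> = ennreal (1 / M) * (\<integral>\<^sup>+x. ennreal ((f x - a)\<^sup>2) \<partial>P)"
        using P.Var_le_second_moment(1)[OF int_f int_f2, of a] mM(2)
        by (subst nn_integral_eq_integral) (auto simp: ennreal_mult'[symmetric])
      also have "\<dots> \<le> (\<integral>\<^sup>+x\<in>X. ennreal ((f x - a)\<^sup>2) \<partial>lborel)"
        unfolding P_def
        by (intro dens(2) measurable_compose[OF _ measurable_ennreal] borel_measurable_continuous_onI
            continuous_intros cont_f)
      finally show "ennreal (Var P f / M) \<le> (\<integral>\<^sup>+x\<in>X. ennreal ((f x - a)\<^sup>2) \<partial>lborel)" .
    qed
    also have "\<dots> \<le> ennreal C0 * (\<integral>\<^sup>+x\<in>X. ennreal (16 * R) * H x \<partial>lborel)"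
    proof (rule poincare[OF cont_f])
      show "segment_bound f (\<lambda>x. ennreal (16 * R) * H x)"
        unfolding f_def H_def by (intro segment_bound_gap_minorant R lip H[unfolded H_def])
    qed measurable
    also have "(\<integral>\<^sup>+x\<in>X. ennreal (16 * R) * H x \<partial>lborel) = ennreal (16 * R) * (\<integral>\<^sup>+x\<in>X. H x \<partial>lborel)"
    proof -
      note X(2) [measurable]
      show ?thesis unfolding mult.assoc by (intro nn_integral_cmult) measurable
    qed
    \<comment> \<open>A factor \<open>m\<close> is inserted to match the bound by
      \<open>E\<close>.\<close>
    also have "(\<integral>\<^sup>+x\<in>X. H x \<partial>lborel) = ennreal (1 / m) * (ennreal m * (\<integral>\<^sup>+x\<in>X. H x \<partial>lborel))"
      using mM by (simp add: mult.assoc[symmetric] flip: ennreal_mult')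
    also have "ennreal C0 * (ennreal (16 * R) * (ennreal (1 / m) * (ennreal m * (\<integral>\<^sup>+x\<in>X. H x \<partial>lborel))))
        \<le> ennreal C0 * (ennreal (16 * R) * (ennreal (1 / m) * ennreal E))"
      by (intro mult_left_mono HE) auto
    also have "\<dots> = ennreal (C0 * (16 * R) / m * E)"
      using C0 R mM E0 by (simp flip: ennreal_mult' add: mult.assoc)
    finally have "Var P f / M \<le> C0 * (16 * R) / m * E"
      using C0 R mM E0 by (subst (asm) ennreal_le_iff) auto
    then have "Var P f \<le> M * (C0 * (16 * R)) / m * E"
      using mM by (simp add: field_simps)
    then show "Var P (\<lambda>x. conjugate_on Y \<psi>1 x - conjugate_on Y \<psi>0 x)
       \<le> M * (C0 * (16 * R)) / m * (Kantorovich X \<rho> Y \<psi>1 - Kantorovich X \<rho> Y \<psi>0 +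
              (LINT y:Y|distr P borel (grad (conjugate_on Y \<psi>0)). \<psi>1 y - \<psi>0 y))"
      unfolding E by (simp add: f_def[abs_def] \<phi>0_def \<phi>1_def)
  qed
qed

end
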